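(* Let $A$ be either $K\{X\}_\infty$ or $K\{X\}$ and let $W$ be its space of primitive elements of positive degree. Then $(A,\Delta_a)$ is the cofree conilpotent cocommutative coalgebra cogenerated by $W$; i.e. $(A,\Delta_a)$ is isomorphic, as a graded counital coalgebra, to the coalgebra $\bigoplus_{n\ge0}(W^{\otimes n})^{\Sigma_n}$ of symmetric tensors in the tensor coalgebra on $W$ with the deconcatenation coproduct.
   Context: $K$ is a field of characteristic $0$ and $X=\{x_1,x_2,\dots\}$ a finite or countable set of variables. A planar rooted tree is reduced if no vertex has exactly one incoming edge. $K\{X\}_\infty$ is the $K$-vector space with basis the "monomials": the empty tree $1$ and all finite planar reduced rooted trees with leaves labelled by elements of $X$. For $k\ge2$, $\vee^k$ sends nonempty monomials $T^1,\dots,T^k$ to the tree obtained by grafting them (in order) onto a new root, extended multilinearly, with unit conventions: arguments equal to $1$ are omitted ($\vee^1=\mathrm{id}$, $\vee^k(1,\dots,1)=1$). This is the free unitary $\mathcal Mag_\omega$-algebra on $X$, graded by number of leaves. $K\{X\}\subset K\{X\}_\infty$ is the span of $1$ and the binary trees, the free unitary magma algebra with $a\cdot b=\vee^2(a,b)$. $A\otimes A$ carries the operations componentwise ($\vee^k(a_1\otimes b_1,\dots,a_k\otimes b_k)=\vee^k(a_1,\dots,a_k)\otimes\vee^k(b_1,\dots,b_k)$, with the unit conventions). The co-addition $\Delta_a:A\to A\otimes A$ is the unique unital homomorphism for these operations with $\Delta_a(x_i)=x_i\otimes1+1\otimes x_i$; counit is the projection onto degree $0$. $f$ is primitive if $\Delta_a(f)=f\otimes1+1\otimes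 f$. *)

theory Defs
  imports Main "HOL-Library.Poly_Mapping" "HOL-Library.Countable" "HOL-Combinatorics.Permutations"
begin

datatype 'x tree = Leaf 'x | Node "'x tree list"

text \<open>Reduced: no vertex has exactly one incoming edge, and all leaves are labelled
  (so an internal vertex has at least two children).\<close>
fun reduced :: "'x tree \<Rightarrow> bool" where
  "reduced (Leaf x) = True"
| "reduced (Node ts) = (2 \<le> length ts \<and> (\<forall>t\<in>set ts. reduced t))"

fun binary :: "'x tree \<Rightarrow> bool" where
  "binary (Leaf x) = True"
| "binary (Node ts) = (length ts = 2 \<and> (\<forall>t\<in>set ts. binary t))"

text \<open>Monomials: None is the empty tree 1, Some t a nonempty tree.\<close>
definition Mono_inf :: "'x tree option set" where
  "Mono_inf = insert None (Some ` {t. reduced t})"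

definition Mono_bin :: "'x tree option set" where
  "Mono_bin = insert None (Some ` {t. binary t})"

fun leaves :: "'x tree \<Rightarrow> nat" where
  "leaves (Leaf x) = 1"
| "leaves (Node ts) = sum_list (map leaves ts)"

definition mdeg :: "'x tree option \<Rightarrow> nat" where
  "mdeg m = (case m of None \<Rightarrow> 0 | Some t \<Rightarrow> leaves t)"

definition span_of :: "'b set \<Rightarrow> ('b \<Rightarrow>\<^sub>0 'k::zero) set" where
  "span_of B = {f. Poly_Mapping.keys f \<subseteq> B}"

definition scal :: "'k::semiring_0 \<Rightarrow> ('b \<Rightarrow>\<^sub>0 'k) \<Rightarrow> ('b \<Rightarrow>\<^sub>0 'k)" where
  "scal c f = Poly_Mapping.map ((*) c) f"

definition basisv :: "'b \<Rightarrow> ('b \<Rightarrow>\<^sub>0 'k::{zero,one})" where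
  "basisv b = Poly_Mapping.single b 1"

definition lin :: "('b \<Rightarrow> ('c \<Rightarrow>\<^sub>0 'k::semiring_1)) \<Rightarrow> ('b \<Rightarrow>\<^sub>0 'k) \<Rightarrow> ('c \<Rightarrow>\<^sub>0 'k)" where
  "lin g f = (\<Sum>b\<in>Poly_Mapping.keys f. scal (Poly_Mapping.lookup f b) (g b))"

fun mlin :: "('b list \<Rightarrow> 'c) \<Rightarrow> ('b \<Rightarrow>\<^sub>0 'k::semiring_1) list \<Rightarrow> ('c \<Rightarrow>\<^sub>0 'k)" where
  "mlin g [] = basisv (g [])"
| "mlin g (f # fs) = lin (\<lambda>b. mlin (\<lambda>bs. g (b # bs)) fs) f"

text \<open>Tensor product of two vectors; the tensor product of spaces with bases
  B, C has basis B \<times> C.\<close>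
definition tens :: "('b \<Rightarrow>\<^sub>0 'k::semiring_1) \<Rightarrow> ('c \<Rightarrow>\<^sub>0 'k) \<Rightarrow> ('b \<times> 'c \<Rightarrow>\<^sub>0 'k)" where
  "tens f g = lin (\<lambda>b. lin (\<lambda>c. basisv (b, c)) g) f"

definition tensmap :: "(('b \<Rightarrow>\<^sub>0 'k::semiring_1) \<Rightarrow> ('d \<Rightarrow>\<^sub>0 'k)) \<Rightarrow>
    (('c \<Rightarrow>\<^sub>0 'k) \<Rightarrow> ('e \<Rightarrow>\<^sub>0 'k)) \<Rightarrow> ('b \<times> 'c \<Rightarrow>\<^sub>0 'k) \<Rightarrow> ('d \<times> 'e \<Rightarrow>\<^sub>0 'k)" where
  "tensmap \<phi> \<psi> = lin (\<lambda>(b, c). tens (\<phi> (basisv b)) (\<psi> (basisv c)))"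

text \<open>Grafting monomials onto a new root, with the unit conventions:
  arguments equal to 1 are omitted, \<or>^1 = id, \<or>^k(1,...,1) = 1.\<close>
definition graft :: "'x tree option list \<Rightarrow> 'x tree option" where
  "graft ms = (case List.map_filter id ms of
                 [] \<Rightarrow> None
               | [t] \<Rightarrow> Some t
               | ts \<Rightarrow> Some (Node ts))"

definition vee :: "('x tree option \<Rightarrow>\<^sub>0 'k::semiring_1) list \<Rightarrow> ('x tree option \<Rightarrow>\<^sub>0 'k)" where
  "vee fs = mlin graft fs"

definition vee2 :: "('x tree option \<times> 'x tree option \<Rightarrow>\<^sub>0 'k::semiring_1) list
     \<Rightarrow> ('x tree option \<times> 'x tree option \<Rightarrow>\<^sub>0 'k)" where
  "vee2 fs = mlin (\<lambda>ps. (graft (map fst ps), graft (map snd ps))) fs"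

text \<open>The co-addition on a nonempty tree: the unital homomorphism for the \<or>^k with
  \<Delta>(x) = x\<otimes>1 + 1\<otimes>x is determined on a tree T = \<or>^k(T1,...,Tk) by
  \<Delta>(T) = \<or>^k(\<Delta> T1, ..., \<Delta> Tk).\<close>
fun coadd_tree :: "'x tree \<Rightarrow> ('x tree option \<times> 'x tree option \<Rightarrow>\<^sub>0 'k::semiring_1)" where
  "coadd_tree (Leaf x) = basisv (Some (Leaf x), None) + basisv (None, Some (Leaf x))"
| "coadd_tree (Node ts) = vee2 (map coadd_tree ts)"

definition coadd_basis :: "'x tree option \<Rightarrow> ('x tree option \<times> 'x tree option \<Rightarrow>\<^sub>0 'k::semiring_1)" where
  "coadd_basis m = (case m of None \<Rightarrow> basisv (None, None) | Some t \<Rightarrow> coadd_tree t)"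

definition coadd :: "('x tree option \<Rightarrow>\<^sub>0 'k::semiring_1) \<Rightarrow> ('x tree option \<times> 'x tree option \<Rightarrow>\<^sub>0 'k)" where
  "coadd f = lin coadd_basis f"

definition counit :: "('x tree option \<Rightarrow>\<^sub>0 'k::zero) \<Rightarrow> 'k" where
  "counit f = Poly_Mapping.lookup f None"

definition primitive :: "('x tree option \<Rightarrow>\<^sub>0 'k::semiring_1) \<Rightarrow> bool" where
  "primitive f \<longleftrightarrow> coadd f = tens f (basisv None) + tens (basisv None) f"

definition Wprim :: "'x tree option set \<Rightarrow> ('x tree option \<Rightarrow>\<^sub>0 'k::semiring_1) set" where
  "Wprim M = {f \<in> span_of M. primitive f \<and> Poly_Mapping.lookup f None = 0}"

text \<open>The tensor coalgebra T(A) = \<Oplus>_n A^{\<otimes>n} has basis the lists of monomials.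
  W^{\<otimes>n} is the subspace spanned by the tensors w1 \<otimes> ... \<otimes> wn, wi \<in> W.\<close>
definition tensor_list :: "('b \<Rightarrow>\<^sub>0 'k::semiring_1) list \<Rightarrow> ('b list \<Rightarrow>\<^sub>0 'k)" where
  "tensor_list ws = mlin id ws"

definition lin_span :: "('c \<Rightarrow>\<^sub>0 'k::semiring_1) set \<Rightarrow> ('c \<Rightarrow>\<^sub>0 'k) set" where
  "lin_span S = {v. \<exists>F c. finite F \<and> F \<subseteq> S \<and> v = (\<Sum>u\<in>F. scal (c u) u)}"

definition tens_power :: "('b \<Rightarrow>\<^sub>0 'k::semiring_1) set \<Rightarrow> nat \<Rightarrow> ('b list \<Rightarrow>\<^sub>0 'k) set" where
  "tens_power W n = lin_span {tensor_list ws | ws. length ws = n \<and> set ws \<subseteq> W}"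

definition perm_word :: "(nat \<Rightarrow> nat) \<Rightarrow> 'b list \<Rightarrow> 'b list" where
  "perm_word \<sigma> l = map (\<lambda>i. l ! \<sigma> i) [0..<length l]"

definition sym_tens :: "('b \<Rightarrow>\<^sub>0 'k::semiring_1) set \<Rightarrow> nat \<Rightarrow> ('b list \<Rightarrow>\<^sub>0 'k) set" where
  "sym_tens W n = {z \<in> tens_power W n. \<forall>\<sigma>. \<sigma> permutes {..<n} \<longrightarrow>
        (\<forall>l. length l = n \<longrightarrow> Poly_Mapping.lookup z (perm_word \<sigma> l) = Poly_Mapping.lookup z l)}"

definition len_part :: "nat \<Rightarrow> ('b list \<Rightarrow>\<^sub>0 'k::semiring_1) \<Rightarrow> ('b list \<Rightarrow>\<^sub>0 'k)" where
  "len_part n z = lin (\<lambda>l. if length l = n then basisv l else 0) z"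

definition sym_coalg :: "('b \<Rightarrow>\<^sub>0 'k::semiring_1) set \<Rightarrow> ('b list \<Rightarrow>\<^sub>0 'k) set" where
  "sym_coalg W = {z. \<forall>n. len_part n z \<in> sym_tens W n}"

definition deconc :: "('b list \<Rightarrow>\<^sub>0 'k::semiring_1) \<Rightarrow> ('b list \<times> 'b list \<Rightarrow>\<^sub>0 'k)" where
  "deconc z = lin (\<lambda>l. \<Sum>i\<le>length l. basisv (take i l, drop i l)) z"

definition tcounit :: "('b list \<Rightarrow>\<^sub>0 'k::zero) \<Rightarrow> 'k" where
  "tcounit z = Poly_Mapping.lookup z []"

definition homog :: "('b \<Rightarrow> nat) \<Rightarrow> nat \<Rightarrow> ('b \<Rightarrow>\<^sub>0 'k::zero) \<Rightarrow> bool" where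
  "homog dg d f \<longleftrightarrow> (\<forall>b\<in>Poly_Mapping.keys f. dg b = d)"

definition wdeg :: "'x tree option list \<Rightarrow> nat" where
  "wdeg l = sum_list (map mdeg l)"

end

theory Submission
  imports Complex_Main Defs
begin

text \<open>A connected cocommutative coalgebra in characteristic 0 is cofree as soon as it carries a unital
product, not necessarily associative, that is a coalgebra morphism; here \<open>\<or>\<^sup>2\<close> is such a product.
Let \<open>D\<^sub>n\<close> be the iterated reduced coproduct with values in the \<open>n\<close>-th tensor power and let \<open>\<pi>\<close> be a
graded projection onto the space \<open>W\<close> of primitive elements.  Then \<open>\<phi> = \<Sum>\<^sub>n \<pi>\<^sup>\<otimes>\<^sup>n D\<^sub>n\<close> is a graded coalgebra
morphism, and its values are symmetric by cocommutativity.

Injectivity: if \<open>D\<^bsub>n+1\<^esub> f = 0\<close>, then every slice of \<open>D\<^sub>n f\<close> through one tensor factor is primitive, so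
\<open>\<pi>\<^sup>\<otimes>\<^sup>n D\<^sub>n f = D\<^sub>n f\<close>; hence \<open>\<phi> f = 0\<close> forces \<open>D\<^sub>n f = 0\<close> for all \<open>n\<close>, by descending induction.

Surjectivity: on right-nested products \<open>w\<^sub>1(w\<^sub>2(\<dots>w\<^sub>n))\<close> of primitive elements \<open>D\<^sub>k\<close> vanishes for \<open>k > n\<close>, and
\<open>D\<^sub>n\<close> is the sum of all permutations of \<open>w\<^sub>1 \<otimes> \<dots> \<otimes> w\<^sub>n\<close>.  So nesting a symmetric tensor of length \<open>n\<close> and dividing
by \<open>n!\<close> inverts \<open>\<phi>\<close> up to tensors of smaller length.\<close>

section \<open>Linear combinations as a commutative monad\<close>

lemma lookup_scal: "Poly_Mapping.lookup (scal c f) x = c * Poly_Mapping.lookup f x"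
  for c :: "'k::semiring_0"
  by (simp add: scal_def Poly_Mapping.map.rep_eq when_def)

lemma lookup_basisv: "Poly_Mapping.lookup (basisv b) x = (if b = x then 1 else 0)"
  by (simp add: basisv_def lookup_single when_def)

lemma keys_basisv: "Poly_Mapping.keys (basisv b :: 'b \<Rightarrow>\<^sub>0 'k::zero_neq_one) = {b}"
  by (simp add: basisv_def)

lemma lookup_lin:
  "Poly_Mapping.lookup (lin g f) x =
     (\<Sum>b\<in>Poly_Mapping.keys f. Poly_Mapping.lookup f b * Poly_Mapping.lookup (g b) x)"
  by (simp add: lin_def Poly_Mapping.lookup_sum lookup_scal)

lemma lookup_lin_superset:
  assumes "finite A" "Poly_Mapping.keys f \<subseteq> A"
  shows "Poly_Mapping.lookup (lin g f) x =
     (\<Sum>b\<in>A. Poly_Mapping.lookup f b * Poly_Mapping.lookup (g b) x)"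
  unfolding lookup_lin
  by (rule sum.mono_neutral_left) (use assms in \<open>auto simp: in_keys_iff\<close>)

lemma lin_cong:
  "(\<And>b. b \<in> Poly_Mapping.keys f \<Longrightarrow> g b = h b) \<Longrightarrow> lin g f = lin h f"
  by (simp add: lin_def)

lemma lin_zero [simp]: "lin g 0 = 0"
  by (simp add: lin_def)

lemma lin_const_zero [simp]: "lin (\<lambda>_. 0) f = 0"
  by (rule poly_mapping_eqI) (simp add: lookup_lin)

lemma lin_basisv [simp]: "lin g (basisv b) = g b"
  for g :: "'b \<Rightarrow> ('c \<Rightarrow>\<^sub>0 'k::{semiring_1,zero_neq_one})"
  by (rule poly_mapping_eqI) (simp add: lookup_lin keys_basisv lookup_basisv)

lemma lin_id [simp]: "lin basisv f = f"
proof (rule poly_mapping_eqI)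
  fix x show "Poly_Mapping.lookup (lin basisv f) x = Poly_Mapping.lookup f x"
    by (cases "x \<in> Poly_Mapping.keys f")
      (auto simp: lookup_lin lookup_basisv in_keys_iff if_distrib sum.delta cong: if_cong)
qed

lemma lin_add [simp]: "lin g (f + f') = lin g f + lin g f'"
proof (rule poly_mapping_eqI)
  fix x
  let ?A = "Poly_Mapping.keys f \<union> Poly_Mapping.keys f'"
  have "Poly_Mapping.keys (f + f') \<subseteq> ?A" by (rule Poly_Mapping.keys_add)
  then show "Poly_Mapping.lookup (lin g (f + f')) x = Poly_Mapping.lookup (lin g f + lin g f') x"
    by (simp add: lookup_add lookup_lin_superset[of ?A] distrib_right sum.distrib)
qed

lemma lin_scal [simp]: "lin g (scal c f) = scal c (lin g f)"
proof (rule poly_mapping_eqI)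
  fix x
  have "Poly_Mapping.keys (scal c f) \<subseteq> Poly_Mapping.keys f"
    by (auto simp: in_keys_iff lookup_scal)
  then show "Poly_Mapping.lookup (lin g (scal c f)) x = Poly_Mapping.lookup (scal c (lin g f)) x"
    by (simp add: lookup_scal lookup_lin_superset[of "Poly_Mapping.keys f"] sum_distrib_left mult.assoc)
qed

lemma lin_sum: "lin g (\<Sum>i\<in>I. f i) = (\<Sum>i\<in>I. lin g (f i))"
  by (induction I rule: infinite_finite_induct) auto

lemma lin_diff: "lin g (f - f') = lin g f - lin g f'"
  for f :: "'b \<Rightarrow>\<^sub>0 'k::ring_1"
  using lin_add[of g "f - f'" f'] by (simp add: algebra_simps)

lemma lin_fun_add: "lin (\<lambda>b. g b + h b) f = lin g f + lin h f"
  by (rule poly_mapping_eqI) (simp add: lookup_lin lookup_add distrib_left sum.distrib)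

lemma lin_fun_sum: "lin (\<lambda>b. \<Sum>i\<in>I. g i b) f = (\<Sum>i\<in>I. lin (g i) f)"
  by (induction I rule: infinite_finite_induct) (auto simp: lin_fun_add)

text \<open>With \<^const>\<open>basisv\<close> as unit, \<^const>\<open>lin\<close> is the bind operation of a monad, which is
  commutative over a commutative ring.  All (multi)linear maps below are written in this monad.\<close>

lemma lin_lin [simp]: "lin g (lin h f) = lin (\<lambda>b. lin g (h b)) f"
  by (simp add: lin_def[of h f] lin_sum) (simp add: lin_def)

lemma lin_commute: "lin (\<lambda>b. lin (\<lambda>c. F b c) g) f = lin (\<lambda>c. lin (\<lambda>b. F b c) f) g"
  for f :: "'b \<Rightarrow>\<^sub>0 'k::comm_semiring_1"
proof (rule poly_mapping_eqI)
  fix x show "Poly_Mapping.lookup (lin (\<lambda>b. lin (\<lambda>c. F b c) g) f) x =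
      Poly_Mapping.lookup (lin (\<lambda>c. lin (\<lambda>b. F b c) f) g) x"
    by (simp add: lookup_lin sum_distrib_left mult.left_commute) (rule sum.swap)
qed

lemma keys_lin: "x \<in> Poly_Mapping.keys (lin g f) \<Longrightarrow>
    \<exists>b\<in>Poly_Mapping.keys f. x \<in> Poly_Mapping.keys (g b)"
  unfolding in_keys_iff lookup_lin by (metis (no_types, lifting) in_keys_iff mult_zero_right sum.neutral)

lemma keys_linE:
  assumes "x \<in> Poly_Mapping.keys (lin g f)"
  obtains b where "b \<in> Poly_Mapping.keys f" "x \<in> Poly_Mapping.keys (g b)"
  using keys_lin[OF assms] by blast

lemma lookup_lin_bij:
  fixes z :: "'b \<Rightarrow>\<^sub>0 'k::{semiring_1,zero_neq_one}"
  assumes "\<And>x. f (f x) = x"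
  shows "Poly_Mapping.lookup (lin (\<lambda>l. basisv (f l)) z) x = Poly_Mapping.lookup z (f x)"
proof -
  have "f b = x \<longleftrightarrow> b = f x" for b using assms by metis
  then show ?thesis
    by (cases "f x \<in> Poly_Mapping.keys z")
      (auto simp: lookup_lin lookup_basisv in_keys_iff if_distrib sum.delta cong: if_cong)
qed

section \<open>Pure tensors and their supports\<close>

lemma tensor_list_Nil [simp]: "tensor_list [] = basisv []"
  by (simp add: tensor_list_def)

text \<open>Universal property of the tensor product: a multilinear extension factors through the
  pure tensor, so multilinear maps become composites in the monad.\<close>

lemma mlin_conv_tensor_list: "mlin g fs = lin (\<lambda>bs. basisv (g bs)) (tensor_list fs)"
  for g :: "'b list \<Rightarrow> 'c" and fs :: "('b \<Rightarrow>\<^sub>0 'k::{semiring_1,zero_neq_one}) list"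
proof -
  \<comment> \<open>The recursion of \<open>mlin\<close> prefixes a letter to the argument of
    \<open>g\<close>, so the claim is generalised over the map \<open>h\<close> that has collected
    these letters.\<close>
  have "mlin (\<lambda>bs. g (h bs)) fs = lin (\<lambda>bs. basisv (g bs)) (mlin h fs)" for h :: "'b list \<Rightarrow> 'b list"
    by (induction fs arbitrary: h) auto
  from this[of id] show ?thesis by (simp add: tensor_list_def)
qed

lemma tensor_list_Cons [simp]:
  "tensor_list (f # fs) = lin (\<lambda>b. lin (\<lambda>bs. basisv (b # bs)) (tensor_list fs)) f"
  for f :: "'b \<Rightarrow>\<^sub>0 'k::{semiring_1,zero_neq_one}"
  by (simp add: tensor_list_def mlin_conv_tensor_list[of "\<lambda>bs. _ # bs"])

lemma tensor_list_append:
  "tensor_list (fs @ gs) =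
     lin (\<lambda>as. lin (\<lambda>bs. basisv (as @ bs)) (tensor_list gs)) (tensor_list fs)"
  for fs :: "('b \<Rightarrow>\<^sub>0 'k::{semiring_1,zero_neq_one}) list"
  by (induction fs) auto

lemma keys_tensor_list:
  "l \<in> Poly_Mapping.keys (tensor_list fs) \<Longrightarrow> list_all2 (\<lambda>b f. b \<in> Poly_Mapping.keys f) l fs"
  for fs :: "('b \<Rightarrow>\<^sub>0 'k::{semiring_1,zero_neq_one}) list"
  by (induction fs arbitrary: l) (auto simp: keys_basisv elim!: keys_linE)

section \<open>Finitely supported functions as a vector space\<close>

interpretation pm: vector_space "scal :: 'k::field \<Rightarrow> ('b \<Rightarrow>\<^sub>0 'k) \<Rightarrow> ('b \<Rightarrow>\<^sub>0 'k)"
  by unfold_locales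
    (auto intro!: poly_mapping_eqI simp: lookup_scal lookup_add algebra_simps)

interpretation pm_pair: vector_space_pair
  "scal :: 'k::field \<Rightarrow> ('b \<Rightarrow>\<^sub>0 'k) \<Rightarrow> ('b \<Rightarrow>\<^sub>0 'k)"
  "scal :: 'k::field \<Rightarrow> ('c \<Rightarrow>\<^sub>0 'k) \<Rightarrow> ('c \<Rightarrow>\<^sub>0 'k)" ..

lemma lin_span_eq_span: "lin_span S = pm.span S"
  for S :: "('b \<Rightarrow>\<^sub>0 'k::field) set"
  unfolding lin_span_def pm.span_explicit by blast

lemma lin_in_subspace:
  fixes f :: "'b \<Rightarrow>\<^sub>0 'k::field"
  assumes "pm.subspace S" "\<And>b. b \<in> Poly_Mapping.keys f \<Longrightarrow> g b \<in> S"
  shows "lin g f \<in> S"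
  unfolding lin_def using assms by (intro pm.subspace_sum pm.subspace_scale) auto

lemma subspace_span_of: "pm.subspace (span_of B :: ('b \<Rightarrow>\<^sub>0 'k::field) set)"
  unfolding pm.subspace_def span_of_def
  by (auto simp: in_keys_iff lookup_scal dest!: subsetD[OF Poly_Mapping.keys_add])

section \<open>Operators on tensor factors and symmetric tensors\<close>

text \<open>The identity on the first \<open>k\<close> tensor factors, tensored with
  \<open>F\<close> on all remaining ones. \<open>F\<close> takes the whole suffix, so it may change
  its length or mix its factors.\<close>

definition under :: "nat \<Rightarrow> ('b list \<Rightarrow> ('b list \<Rightarrow>\<^sub>0 'k::semiring_1)) \<Rightarrow> 'b list \<Rightarrow> ('b list \<Rightarrow>\<^sub>0 'k)" where
  "under k F l = lin (\<lambda>l'. basisv (take k l @ l')) (F (drop k l))"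

fun under_hd :: "('b list \<Rightarrow> ('b list \<Rightarrow>\<^sub>0 'k::semiring_1)) \<Rightarrow> 'b list \<Rightarrow> ('b list \<Rightarrow>\<^sub>0 'k)" where
  "under_hd F [] = basisv []"
| "under_hd F (a # l) = lin (\<lambda>l'. basisv (a # l')) (F l)"

lemma under_append:
  "length p = k \<Longrightarrow> under k F (p @ l) = lin (\<lambda>l'. basisv (p @ l')) (F l)"
  by (simp add: under_def)

lemma under_0: "under 0 F = F"
  by (rule ext) (simp add: under_def)

lemma list_split_at:
  assumes "k \<le> length l"
  obtains p q where "l = p @ q" "length p = k"
  using assms by (metis append_take_drop_id length_take min.absorb2)

lemma lin_under: "k \<le> length l \<Longrightarrow> lin (under k G) (under k F l) = under k (\<lambda>l. lin G (F l)) l"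
  for l :: "'b list"
  by (erule list_split_at) (simp add: under_append)

lemma under_Suc: "k < length l \<Longrightarrow> under (Suc k) F l = under k (under_hd F) l"
  for F :: "'b list \<Rightarrow> ('b list \<Rightarrow>\<^sub>0 'k::semiring_1)"
proof -
  assume "k < length l"
  then obtain p q where l: "l = p @ q" "length p = k" "q \<noteq> []"
    by (metis append_take_drop_id length_take min.absorb2 less_imp_le drop_eq_Nil not_less)
  then obtain a q' where q: "q = a # q'" by (cases q) auto
  from under_append[of "p @ [a]" "Suc k" F q'] under_append[of p k "under_hd F" q]
  show ?thesis by (simp add: l q)
qed

lemma under_cong: "F (drop k l) = G (drop k l) \<Longrightarrow> under k F l = under k G l"
  by (simp add: under_def)

text \<open>Operators given by their action on a first letter are compared here:
  \<open>k < n\<close> guarantees that the suffix has one.\<close>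

lemma lin_under_cong:
  assumes "\<And>l. l \<in> Poly_Mapping.keys z \<Longrightarrow> length l = n" and "k < n"
    and "\<And>a l. F (a # l) = G (a # l)"
  shows "lin (under k F) z = lin (under k G) z"
proof (rule lin_cong, rule under_cong)
  fix l assume "l \<in> Poly_Mapping.keys z"
  then have "drop k l \<noteq> []" using assms by (simp add: leD)
  then show "F (drop k l) = G (drop k l)" using assms by (cases "drop k l") auto
qed

text \<open>Base case of the inductions below that run downwards from \<open>k = n\<close>, where
  the suffix is empty.\<close>

lemma lin_under_full:
  assumes "\<And>l. l \<in> Poly_Mapping.keys z \<Longrightarrow> length l = n" and "F [] = basisv []"
  shows "lin (under n F) z = z"
proof -
  have "lin (under n F) z = lin basisv z"
    by (rule lin_cong) (simp add: under_def assms)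
  then show ?thesis by simp
qed

fun swap2 :: "'b list \<Rightarrow> 'b list" where
  "swap2 (a # b # l) = b # a # l"
| "swap2 l = l"

abbreviation swapv :: "'b list \<Rightarrow> ('b list \<Rightarrow>\<^sub>0 'k::semiring_1)" where
  "swapv l \<equiv> basisv (swap2 l)"

lemma swap2_swap2 [simp]: "swap2 (swap2 l) = l"
  by (induction l rule: swap2.induct) auto

lemma mset_swap2 [simp]: "mset (swap2 l) = mset l"
  by (induction l rule: swap2.induct) auto

text \<open>Invariance under all adjacent transpositions. \<open>k\<close> ranges over all naturals,
  because \<open>swap2\<close> is the identity on suffixes of fewer than two letters.\<close>

definition swap_invariant :: "('b list \<Rightarrow>\<^sub>0 'k::semiring_1) \<Rightarrow> bool" where
  "swap_invariant z \<longleftrightarrow> (\<forall>k. lin (under k swapv) z = z)"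

lemma lookup_lin_under_swapv:
  "Poly_Mapping.lookup (lin (under k swapv) z) l = Poly_Mapping.lookup z (take k l @ swap2 (drop k l))"
proof -
  define f where "f l = take k l @ swap2 (drop k l)" for l :: "'b list"
  have "f (f l) = l" for l
    by (cases "k \<le> length l") (auto simp: f_def)
  from lookup_lin_bij[of f, OF this] show ?thesis
    by (simp add: f_def under_def[abs_def])
qed

lemma swap_invariant_lookup:
  assumes "swap_invariant z"
  shows "Poly_Mapping.lookup z (p @ a # b # q) = Poly_Mapping.lookup z (p @ b # a # q)"
  using lookup_lin_under_swapv[of "length p" z "p @ a # b # q"] assms
  by (simp add: swap_invariant_def)

text \<open>A letter is bubbled through a block by adjacent swaps. So the first letter of
  \<open>xs\<close> can be matched with an occurrence in \<open>ys\<close>, and the induction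
  continues behind a longer prefix.\<close>

lemma swap_invariant_mset:
  assumes z: "swap_invariant z" and "mset xs = mset ys"
  shows "Poly_Mapping.lookup z xs = Poly_Mapping.lookup z ys"
proof -
  have move: "Poly_Mapping.lookup z (p @ x # ys @ q) = Poly_Mapping.lookup z (p @ ys @ x # q)" for p x ys q
  proof (induction ys arbitrary: p)
    case (Cons y ys)
    have "Poly_Mapping.lookup z (p @ x # y # ys @ q) = Poly_Mapping.lookup z ((p @ [y]) @ x # ys @ q)"
      using swap_invariant_lookup[OF z, of p x y "ys @ q"] by simp
    also have "\<dots> = Poly_Mapping.lookup z (p @ (y # ys) @ x # q)"
      by (subst Cons.IH) simp
    finally show ?case by simp
  qed simp
  have "Poly_Mapping.lookup z (p @ xs) = Poly_Mapping.lookup z (p @ ys)" if "mset xs = mset ys" for p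
    using that
  proof (induction xs arbitrary: ys p)
    case (Cons x xs)
    then have "x \<in> set ys" by (metis list.set_intros(1) set_mset_mset)
    then obtain y1 y2 where ys: "ys = y1 @ x # y2" by (meson split_list)
    then have "mset xs = mset (y1 @ y2)" using Cons.prems by simp
    from Cons.IH[OF this, of "p @ [x]"] move[of p x y1 y2] show ?case
      by (simp add: ys)
  qed simp
  from this[of "[]"] show ?thesis using assms by simp
qed

text \<open>\<^const>\<open>swap_invariant\<close> is the invariance in \<^const>\<open>sym_tens\<close>, since adjacent transpositions
  generate the symmetric group.\<close>

lemma swap_invariant_iff:
  fixes z :: "'b list \<Rightarrow>\<^sub>0 'k::semiring_1"
  assumes len: "\<And>l. l \<in> Poly_Mapping.keys z \<Longrightarrow> length l = n"
  shows "swap_invariant z \<longleftrightarrow> (\<forall>\<sigma>. \<sigma> permutes {..<n} \<longrightarrow>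
        (\<forall>l. length l = n \<longrightarrow> Poly_Mapping.lookup z (perm_word \<sigma> l) = Poly_Mapping.lookup z l))"
    (is "_ \<longleftrightarrow> ?R")
proof
  have pw: "perm_word \<sigma> l = permute_list \<sigma> l" for \<sigma> and l :: "'b list"
    by (simp add: perm_word_def permute_list_def)
  { assume "swap_invariant z"
    then show ?R by (auto simp: pw intro!: swap_invariant_mset) }
  assume R: ?R
  show "swap_invariant z"
    unfolding swap_invariant_def
  proof (intro allI poly_mapping_eqI)
    fix k and l :: "'b list"
    let ?l' = "take k l @ swap2 (drop k l)"
    have m: "mset ?l' = mset l"
      by (metis append_take_drop_id mset_append mset_swap2)
    have "Poly_Mapping.lookup z ?l' = Poly_Mapping.lookup z l"
    proof (cases "length l = n")
      case True
      from m obtain p where "p permutes {..<length l}" "permute_list p l = ?l'"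
        by (rule mset_eq_permutation)
      then show ?thesis using R True by (metis pw)
    next
      case False
      moreover from this have "length ?l' \<noteq> n" using m by (metis size_mset)
      ultimately show ?thesis using len by (metis not_in_keys_iff_lookup_eq_zero)
    qed
    then show "Poly_Mapping.lookup (lin (under k swapv) z) l = Poly_Mapping.lookup z l"
      by (simp add: lookup_lin_under_swapv)
  qed
qed

section \<open>Insertion of letters and symmetrization\<close>

text \<open>The shuffle of the one-letter word \<open>a\<close> with a word: a sum over all places
  where \<open>a\<close> can stand, counted with multiplicity.\<close>

fun ins :: "'b \<Rightarrow> 'b list \<Rightarrow> ('b list \<Rightarrow>\<^sub>0 'k::semiring_1)" where
  "ins a [] = basisv [a]"
| "ins a (b # l) = basisv (a # b # l) + lin (\<lambda>l'. basisv (b # l')) (ins a l)"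

fun ins_hd :: "'b list \<Rightarrow> ('b list \<Rightarrow>\<^sub>0 'k::semiring_1)" where
  "ins_hd [] = basisv []"
| "ins_hd (a # l) = ins a l"

text \<open>The sum over all permutations of the word, with multiplicity, built letter by letter to
  match the behaviour of iterated coproducts on nested products.\<close>

fun symmetrize :: "'b list \<Rightarrow> ('b list \<Rightarrow>\<^sub>0 'k::semiring_1)" where
  "symmetrize [] = basisv []"
| "symmetrize (a # l) = lin (ins a) (symmetrize l)"

text \<open>Each of the \<open>n - k\<close> insertions of the letter at position \<open>k\<close>
  reproduces an invariant tensor. By the recursion of \<open>ins\<close>, either the letter stays in
  front, which gives the word back, or the first two letters are swapped and the insertion continues
  one position later.\<close>

lemma lin_under_ins_hd:
  fixes z :: "'b list \<Rightarrow>\<^sub>0 'k::field"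
  assumes len: "\<And>l. l \<in> Poly_Mapping.keys z \<Longrightarrow> length l = n" and z: "swap_invariant z" and "k < n"
  shows "lin (under k ins_hd) z = scal (of_nat (n - k)) z"
  using \<open>k < n\<close>
proof (induction "n - Suc k" arbitrary: k)
  case 0
  then have n: "n = Suc k" by simp
  have "lin (under k ins_hd) z = lin basisv z"
  proof (rule lin_cong)
    fix l assume "l \<in> Poly_Mapping.keys z"
    then have "length l = Suc k" using len n by simp
    then obtain p a where "l = p @ [a]" "length p = k"
      by (metis length_append_singleton append_butlast_last_id length_0_conv nat.inject old.nat.distinct(1))
    then show "under k ins_hd l = basisv l" by (simp add: under_append)
  qed
  then show ?case by (simp add: n)
next
  case (Suc d)
  have "lin (under k ins_hd) z = lin (\<lambda>l. basisv l + lin (under (Suc k) ins_hd) (under k swapv l)) z"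
  proof (rule lin_cong)
    fix l assume "l \<in> Poly_Mapping.keys z"
    then have l: "length l = n" by (rule len)
    then obtain p q where pq: "l = p @ q" "length p = k" using list_split_at[of k l] Suc by auto
    then obtain a b r where q: "q = a # b # r"
      using l Suc(2,3) by (cases q; cases "tl q") auto
    have "under (Suc k) ins_hd (p @ b # a # r) =
        (under k (under_hd ins_hd) (p @ b # a # r) :: 'b list \<Rightarrow>\<^sub>0 'k)"
      by (rule under_Suc) (simp add: pq)
    then show "(under k ins_hd l :: 'b list \<Rightarrow>\<^sub>0 'k) = basisv l + lin (under (Suc k) ins_hd) (under k swapv l)"
      by (simp add: under_append pq q)
  qed
  also have "\<dots> = z + lin (under (Suc k) ins_hd) (lin (under k swapv) z)"
    by (simp add: lin_fun_add)
  also have "lin (under k swapv) z = z" using z by (simp add: swap_invariant_def)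
  also have "lin (under (Suc k) ins_hd) z = scal (of_nat (n - Suc k)) z"
    using Suc by (intro Suc.hyps) auto
  also have "z + \<dots> = scal (of_nat (Suc (n - Suc k))) z"
    by (rule poly_mapping_eqI) (simp add: lookup_add lookup_scal algebra_simps)
  also have "Suc (n - Suc k) = n - k" using Suc.prems by simp
  finally show ?case .
qed

text \<open>Symmetrizing the suffix behind position \<open>k\<close> multiplies by
  \<open>fact (n - k)\<close>: going down from \<open>k = n\<close>, each further insertion
  contributes the factor \<open>n - k\<close> of \<open>lin_under_ins_hd\<close>.\<close>

lemma lin_symmetrize:
  fixes z :: "'b list \<Rightarrow>\<^sub>0 'k::field_char_0"
  assumes len: "\<And>l. l \<in> Poly_Mapping.keys z \<Longrightarrow> length l = n" and z: "swap_invariant z"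
  shows "lin symmetrize z = scal (fact n) z"
proof -
  have "lin (under k symmetrize) z = scal (fact (n - k)) z" if "k \<le> n" for k
    using that
  proof (induction "n - k" arbitrary: k)
    case 0
    then have "k = n" by simp
    then show ?case using lin_under_full[of z n symmetrize] len by simp
  next
    case (Suc d)
    then have k: "k < n" by simp
    have "lin (under k symmetrize) z = lin (under k (\<lambda>l. lin ins_hd (under_hd symmetrize l))) z"
      by (rule lin_under_cong[OF len k]) auto
    also have "\<dots> = lin (under k ins_hd) (lin (under (Suc k) symmetrize) z)"
      unfolding lin_lin by (rule lin_cong) (use len k in \<open>simp add: under_Suc lin_under\<close>)
    also have "lin (under (Suc k) symmetrize) z = scal (fact (n - Suc k)) z"
      using Suc by (intro Suc.hyps) auto
    also have "lin (under k ins_hd) \<dots> = scal (fact (n - Suc k) * of_nat (n - k)) z"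
      using lin_under_ins_hd[OF len z k] by simp
    also have "fact (n - Suc k) * of_nat (n - k) = (fact (n - k) :: 'k)"
      using k by (metis Suc_diff_Suc fact_Suc mult.commute)
    finally show ?case .
  qed
  from this[of 0] show ?thesis by (simp add: under_0)
qed

section \<open>Length components and tensor products of vectors\<close>

lemma len_part_eq:
  assumes "\<And>l. l \<in> Poly_Mapping.keys z \<Longrightarrow> length l = k"
  shows "len_part n z = (if n = k then z else 0)"
proof -
  have "len_part n z = lin (\<lambda>l. if n = k then basisv l else 0) z"
    unfolding len_part_def by (rule lin_cong) (use assms in auto)
  then show ?thesis by simp
qed

lemma lookup_len_part:
  "Poly_Mapping.lookup (len_part n z) l = (if length l = n then Poly_Mapping.lookup z l else 0)"
proof -
  have "Poly_Mapping.lookup (len_part n z) l =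
      (if length l = n then Poly_Mapping.lookup (lin basisv z) l else 0)"
    unfolding len_part_def lookup_lin
    by (auto intro!: sum.cong sum.neutral simp: lookup_basisv)
  then show ?thesis by simp
qed

lemma tens_lin:
  fixes x :: "'b \<Rightarrow>\<^sub>0 'k::comm_semiring_1"
  shows "tens (lin F x) (lin G y) = lin (\<lambda>a. lin (\<lambda>b. tens (F a) (G b)) y) x"
  unfolding tens_def lin_lin by (intro lin_cong) (rule lin_commute)

lemma tens_sum: "tens (\<Sum>i\<in>I. x i) (\<Sum>j\<in>J. y j) = (\<Sum>i\<in>I. \<Sum>j\<in>J. tens (x i) (y j))"
  by (simp add: tens_def lin_sum lin_fun_sum) (rule sum.swap)

lemma tens_0 [simp]: "tens 0 y = 0" "tens x 0 = 0"
  by (simp_all add: tens_def)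

section \<open>Connected cocommutative coalgebras with a unital product\<close>

text \<open>\<open>M\<close> is a basis inside a larger type, and all structure is given on basis
  elements. \<open>dg_0_iff\<close> expresses connectedness, \<open>comult_mul\<close> makes the
  product a coalgebra morphism, and \<open>mul_eq_unit\<close> keeps a product with a left factor
  other than \<open>u\<close> away from the unit. The right counit law follows from
  cocommutativity.\<close>

locale connected_magma_coalgebra =
  fixes M :: "'b set" and u :: 'b and \<Delta> :: "'b \<Rightarrow> ('b \<times> 'b \<Rightarrow>\<^sub>0 'k::field_char_0)"
    and dg :: "'b \<Rightarrow> nat" and mul :: "'b \<Rightarrow> 'b \<Rightarrow> 'b"
  assumes unit_in: "u \<in> M"
    and comult_keys: "\<lbrakk>m \<in> M; p \<in> Poly_Mapping.keys (\<Delta> m)\<rbrakk> \<Longrightarrow>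
      fst p \<in> M \<and> snd p \<in> M \<and> dg (fst p) + dg (snd p) = dg m"
    and dg_0_iff: "m \<in> M \<Longrightarrow> dg m = 0 \<longleftrightarrow> m = u"
    and comult_unit: "\<Delta> u = basisv (u, u)"
    and counit_left: "m \<in> M \<Longrightarrow>
      lin (\<lambda>p. if fst p = u then basisv (snd p) else 0) (\<Delta> m) = basisv m"
    and coassoc: "m \<in> M \<Longrightarrow>
      lin (\<lambda>p. lin (\<lambda>q. basisv (fst q, snd q, snd p)) (\<Delta> (fst p))) (\<Delta> m) =
      lin (\<lambda>p. lin (\<lambda>q. basisv (fst p, fst q, snd q)) (\<Delta> (snd p))) (\<Delta> m)"
    and cocomm: "m \<in> M \<Longrightarrow> lin (\<lambda>p. basisv (snd p, fst p)) (\<Delta> m) = \<Delta> m"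
    and mul_in: "\<lbrakk>a \<in> M; b \<in> M\<rbrakk> \<Longrightarrow> mul a b \<in> M"
    and mul_unit_left: "a \<in> M \<Longrightarrow> mul u a = a"
    and mul_unit_right: "a \<in> M \<Longrightarrow> mul a u = a"
    and mul_eq_unit: "\<lbrakk>a \<in> M; b \<in> M; mul a b = u\<rbrakk> \<Longrightarrow> a = u"
    and comult_mul: "\<lbrakk>a \<in> M; b \<in> M\<rbrakk> \<Longrightarrow> \<Delta> (mul a b) =
      lin (\<lambda>p. lin (\<lambda>q. basisv (mul (fst p) (fst q), mul (snd p) (snd q))) (\<Delta> b)) (\<Delta> a)"
begin

section \<open>Sweedler calculus: the axioms composed with arbitrary linear maps\<close>

lemma counit_left': "m \<in> M \<Longrightarrow> lin (\<lambda>p. if fst p = u then F (snd p) else 0) (\<Delta> m) = F m"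
  for F :: "'b \<Rightarrow> ('c \<Rightarrow>\<^sub>0 'k)"
  using arg_cong[OF counit_left[of m], of "lin F"] by (simp add: if_distrib[of "lin F"] cong: if_cong)

lemma coassoc': "m \<in> M \<Longrightarrow>
    lin (\<lambda>p. lin (\<lambda>q. F (fst q) (snd q) (snd p)) (\<Delta> (fst p))) (\<Delta> m) =
    lin (\<lambda>p. lin (\<lambda>q. F (fst p) (fst q) (snd q)) (\<Delta> (snd p))) (\<Delta> m)"
  for F :: "'b \<Rightarrow> 'b \<Rightarrow> 'b \<Rightarrow> ('c \<Rightarrow>\<^sub>0 'k)"
  using arg_cong[OF coassoc[of m], of "lin (\<lambda>t. F (fst t) (fst (snd t)) (snd (snd t)))"] by simp

lemma cocomm': "m \<in> M \<Longrightarrow> lin (\<lambda>p. F (snd p) (fst p)) (\<Delta> m) = lin (\<lambda>p. F (fst p) (snd p)) (\<Delta> m)"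
  for F :: "'b \<Rightarrow> 'b \<Rightarrow> ('c \<Rightarrow>\<^sub>0 'k)"
  using arg_cong[OF cocomm[of m], of "lin (\<lambda>t. F (fst t) (snd t))"] by simp

lemma counit_right': "m \<in> M \<Longrightarrow> lin (\<lambda>p. if snd p = u then F (fst p) else 0) (\<Delta> m) = F m"
  for F :: "'b \<Rightarrow> ('c \<Rightarrow>\<^sub>0 'k)"
  using cocomm'[of m "\<lambda>a b. if a = u then F b else 0"] counit_left'[of m F] by simp

section \<open>The reduced coproduct and its iterates\<close>

definition rcomult :: "'b \<Rightarrow> ('b \<times> 'b \<Rightarrow>\<^sub>0 'k)" where
  "rcomult m = lin (\<lambda>p. if fst p = u \<or> snd p = u then 0 else basisv p) (\<Delta> m)"

lemma lin_rcomult: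
  "lin F (rcomult m) = lin (\<lambda>p. if fst p = u \<or> snd p = u then 0 else F p) (\<Delta> m)"
  by (simp add: rcomult_def if_distrib[of "lin F"] cong: if_cong)

lemma comult_reduced:
  assumes "m \<in> M" "m \<noteq> u"
  shows "\<Delta> m = basisv (u, m) + basisv (m, u) + rcomult m"
proof -
  \<comment> \<open>The terms are sorted by which factor is the unit. The second summand excludes
    \<open>fst p = u\<close>, so that a term at \<open>(u, u)\<close> is not counted twice.\<close>
  have "lin basisv (\<Delta> m) = lin (\<lambda>p. (if fst p = u then basisv (u, snd p) else 0) +
      (if snd p = u then (if fst p \<noteq> u then basisv (fst p, u) else 0) else 0) +
      (if fst p = u \<or> snd p = u then 0 else basisv p)) (\<Delta> m)"
    by (rule lin_cong) (auto simp: prod_eq_iff)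
  also have "\<dots> = basisv (u, m) + basisv (m, u) + rcomult m"
    using assms counit_left'[of m "\<lambda>b. basisv (u, b)"]
      counit_right'[of m "\<lambda>b. if b \<noteq> u then basisv (b, u) else 0"]
    by (simp add: lin_fun_add rcomult_def)
  finally show ?thesis by simp
qed

text \<open>\<^term>\<open>D n\<close> is the iterated reduced coproduct with values in the \<^term>\<open>n\<close>-th tensor power of
  the augmentation ideal.\<close>

primrec D :: "nat \<Rightarrow> 'b \<Rightarrow> ('b list \<Rightarrow>\<^sub>0 'k)" where
  "D 0 m = (if m = u then basisv [] else 0)"
| "D (Suc n) m =
    lin (\<lambda>p. if fst p = u then 0 else lin (\<lambda>l. basisv (fst p # l)) (D n (snd p))) (\<Delta> m)"

lemma keys_D:
  "\<lbrakk>m \<in> M; l \<in> Poly_Mapping.keys (D n m)\<rbrakk> \<Longrightarrow>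
     length l = n \<and> set l \<subseteq> M - {u} \<and> sum_list (map dg l) = dg m"
proof (induction n arbitrary: m l)
  case 0
  then show ?case using dg_0_iff[of u] unit_in by (auto simp: keys_basisv split: if_splits)
next
  case (Suc n)
  from Suc.prems(2) obtain p l' where p: "p \<in> Poly_Mapping.keys (\<Delta> m)" "fst p \<noteq> u"
    and l': "l' \<in> Poly_Mapping.keys (D n (snd p))" "l = fst p # l'"
    by (auto elim!: keys_linE simp: keys_basisv split: if_splits)
  from comult_keys[OF Suc.prems(1) p(1)] Suc.IH[OF _ l'(1)] p(2) l'(2) show ?case
    by auto
qed

lemma length_D: "\<lbrakk>m \<in> M; l \<in> Poly_Mapping.keys (D n m)\<rbrakk> \<Longrightarrow> length l = n"
  using keys_D by blast

text \<open>Conilpotency: a word in the support would have \<open>n\<close> letters, each of degree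
  at least 1, with total degree \<open>dg m\<close>.\<close>

lemma D_eq_0: assumes "m \<in> M" "dg m < n" shows "D n m = 0"
proof -
  have "l \<notin> Poly_Mapping.keys (D n m)" for l
  proof
    assume "l \<in> Poly_Mapping.keys (D n m)"
    from keys_D[OF assms(1) this] have l: "length l = n" "set l \<subseteq> M - {u}" "sum_list (map dg l) = dg m"
      by auto
    have "length l \<le> sum_list (map dg l)"
      using l(2) by (induction l) (use dg_0_iff in force)+
    with l assms show False by simp
  qed
  then show ?thesis by (metis ex_in_conv keys_eq_empty)
qed

text \<open>Iterated coassociativity: the first \<open>i\<close> and the last \<open>j\<close>
  factors may be taken from the two halves of one coproduct. Each induction step moves one factor
  across by coassociativity.\<close>

lemma D_add:
  assumes "m \<in> M"
  shows "D (i + j) m =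
    lin (\<lambda>p. lin (\<lambda>l. lin (\<lambda>l'. basisv (l @ l')) (D j (snd p))) (D i (fst p))) (\<Delta> m)"
  using assms
proof (induction i arbitrary: m)
  case 0
  have "lin (\<lambda>p. lin (\<lambda>l. lin (\<lambda>l'. basisv (l @ l')) (D j (snd p))) (D 0 (fst p))) (\<Delta> m)
      = lin (\<lambda>p. if fst p = u then D j (snd p) else 0) (\<Delta> m)"
    by (rule lin_cong) auto
  then show ?case using counit_left'[OF 0, of "D j"] by simp
next
  case (Suc i)
  define F where "F a b c = (if a = u then 0 else
    lin (\<lambda>l. lin (\<lambda>l'. basisv (a # l @ l')) (D j c)) (D i b))" for a b c
  have "D (Suc i + j) m = lin (\<lambda>p. lin (\<lambda>q. F (fst p) (fst q) (snd q)) (\<Delta> (snd p))) (\<Delta> m)"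
    unfolding add_Suc D.simps
    by (intro lin_cong) (use Suc.prems comult_keys in \<open>auto simp: F_def Suc.IH\<close>)
  also have "\<dots> = lin (\<lambda>p. lin (\<lambda>q. F (fst q) (snd q) (snd p)) (\<Delta> (fst p))) (\<Delta> m)"
    by (rule coassoc'[OF Suc.prems, symmetric])
  also have "\<dots> = lin (\<lambda>p. lin (\<lambda>l. lin (\<lambda>l'. basisv (l @ l')) (D j (snd p))) (D (Suc i) (fst p))) (\<Delta> m)"
    by (auto intro!: lin_cong simp: F_def)
  finally show ?case .
qed

text \<open>Coassociativity regroups the first two factors into one coproduct, where cocommutativity
  or the reduced coproduct can act on them.\<close>

lemma D_Suc_Suc:
  assumes "m \<in> M"
  shows "D (Suc (Suc j)) m = lin (\<lambda>p. lin (\<lambda>q. if fst q = u \<or> snd q = u then 0 else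
      lin (\<lambda>l. basisv (fst q # snd q # l)) (D j (snd p))) (\<Delta> (fst p))) (\<Delta> m)"
proof -
  define F where "F a b c = (if a = u \<or> b = u then 0 else
    lin (\<lambda>l. basisv (a # b # l)) (D j c))" for a b c
  have "D (Suc (Suc j)) m = lin (\<lambda>p. lin (\<lambda>q. F (fst p) (fst q) (snd q)) (\<Delta> (snd p))) (\<Delta> m)"
    by (auto intro!: lin_cong simp: F_def if_distrib[of "lin _"] cong: if_cong)
  also have "\<dots> = lin (\<lambda>p. lin (\<lambda>q. F (fst q) (snd q) (snd p)) (\<Delta> (fst p))) (\<Delta> m)"
    by (rule coassoc'[OF assms, symmetric])
  finally show ?thesis by (simp add: F_def)
qed

lemma lin_swapv_D:
  assumes "m \<in> M"
  shows "lin swapv (D (Suc (Suc j)) m) = D (Suc (Suc j)) m"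
proof -
  define F where "F a b c = (if a = u \<or> b = u then 0 else
    lin (\<lambda>l. basisv (a # b # l)) (D j c))" for a b c
  have "lin swapv (D (Suc (Suc j)) m) =
      lin (\<lambda>p. lin (\<lambda>q. F (snd q) (fst q) (snd p)) (\<Delta> (fst p))) (\<Delta> m)"
    unfolding D_Suc_Suc[OF assms] lin_lin
    by (auto intro!: lin_cong simp: F_def if_distrib[of "lin _"] cong: if_cong)
  also have "\<dots> = lin (\<lambda>p. lin (\<lambda>q. F (fst q) (snd q) (snd p)) (\<Delta> (fst p))) (\<Delta> m)"
  proof (rule lin_cong)
    fix p assume "p \<in> Poly_Mapping.keys (\<Delta> m)"
    then have "fst p \<in> M" using comult_keys assms by blast
    from cocomm'[OF this, of "\<lambda>a b. F a b (snd p)"]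
    show "lin (\<lambda>q. F (snd q) (fst q) (snd p)) (\<Delta> (fst p)) =
      lin (\<lambda>q. F (fst q) (snd q) (snd p)) (\<Delta> (fst p))" .
  qed
  finally show ?thesis unfolding D_Suc_Suc[OF assms] F_def .
qed

text \<open>By \<open>D_add\<close>, a rule for the iterates that acts at the front also holds at
  position \<open>k\<close>: the first \<open>k\<close> factors come from the other half of a
  coproduct and stay fixed.\<close>

lemma lin_under_D:
  assumes "m \<in> M" and "\<And>m. m \<in> M \<Longrightarrow> lin F (D j m) = D j' m"
  shows "lin (under k F) (D (k + j) m) = D (k + j') m"
  unfolding D_add[OF assms(1)] lin_lin lin_basisv
proof (rule lin_cong)
  fix p assume "p \<in> Poly_Mapping.keys (\<Delta> m)"
  then have p: "fst p \<in> M" "snd p \<in> M" using comult_keys assms(1) by blast+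
  have "lin (\<lambda>l'. under k F (l @ l')) (D j (snd p)) = lin (\<lambda>l'. basisv (l @ l')) (D j' (snd p))"
    if "l \<in> Poly_Mapping.keys (D k (fst p))" for l
    using arg_cong[OF assms(2)[OF p(2)], of "lin (\<lambda>l'. basisv (l @ l'))"] length_D[OF p(1) that]
    by (simp add: under_append)
  then show "lin (\<lambda>l. lin (\<lambda>l'. under k F (l @ l')) (D j (snd p))) (D k (fst p)) =
    lin (\<lambda>l. lin (\<lambda>l'. basisv (l @ l')) (D j' (snd p))) (D k (fst p))"
    by (intro lin_cong) auto
qed

section \<open>Primitive elements and a graded projection onto them\<close>

definition prim :: "('b \<Rightarrow>\<^sub>0 'k) set" where
  "prim = {f \<in> span_of M. lin \<Delta> f = tens f (basisv u) + tens (basisv u) f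
     \<and> Poly_Mapping.lookup f u = 0}"

lemma prim_iff: "f \<in> prim \<longleftrightarrow> Poly_Mapping.keys f \<subseteq> M - {u} \<and>
    lin \<Delta> f = lin (\<lambda>b. basisv (b, u)) f + lin (\<lambda>b. basisv (u, b)) f"
  by (auto simp: prim_def span_of_def tens_def in_keys_iff)

lemma subspace_prim: "pm.subspace prim"
proof -
  have "pm.subspace (span_of (M - {u}) :: ('b \<Rightarrow>\<^sub>0 'k) set)" by (rule subspace_span_of)
  then show ?thesis
    unfolding pm.subspace_def span_of_def mem_Collect_eq Ball_def prim_iff
    by (simp add: pm.scale_right_distrib)
qed

lemma prim_if_lin_rcomult_eq_0:
  assumes s: "Poly_Mapping.keys s \<subseteq> M - {u}" "lin rcomult s = 0"
  shows "s \<in> prim"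
proof -
  have "lin \<Delta> s = lin (\<lambda>m. basisv (m, u) + basisv (u, m) + rcomult m) s"
    by (rule lin_cong) (use s comult_reduced in \<open>auto simp: add.commute\<close>)
  then show ?thesis using s by (simp add: prim_iff lin_fun_add)
qed

lemma homog_component_prim:
  assumes "f \<in> prim"
  shows "lin (\<lambda>b. if dg b = d then basisv b else 0) f \<in> prim"
proof -
  let ?h = "lin (\<lambda>b. if dg b = d then basisv b else 0) f"
  \<comment> \<open>Projection of the tensor square onto total degree \<open>d\<close>. The
    coproduct preserves degree, so it carries the component of \<open>f\<close> to the component of
    \<open>lin \<Delta> f\<close>.\<close>
  let ?g = "\<lambda>p. if dg (fst p) + dg (snd p) = d then basisv p else 0"
  have f: "Poly_Mapping.keys f \<subseteq> M - {u}"
    "lin \<Delta> f = lin (\<lambda>b. basisv (b, u)) f + lin (\<lambda>b. basisv (u, b)) f"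
    using assms by (auto simp: prim_iff)
  have "lin \<Delta> ?h = lin ?g (lin \<Delta> f)"
    unfolding lin_lin
  proof (rule lin_cong)
    fix b assume "b \<in> Poly_Mapping.keys f"
    then have b: "b \<in> M" using f by auto
    have "lin ?g (\<Delta> b) = lin (\<lambda>p. if dg b = d then basisv p else 0) (\<Delta> b)"
      by (rule lin_cong) (use comult_keys[OF b] in auto)
    then show "lin \<Delta> (if dg b = d then basisv b else 0) = lin ?g (\<Delta> b)"
      by simp
  qed
  also have "\<dots> = lin (\<lambda>b. basisv (b, u)) ?h + lin (\<lambda>b. basisv (u, b)) ?h"
    using dg_0_iff[OF unit_in] by (simp add: f(2) if_distrib[of "lin _"] cong: if_cong)
  finally show ?thesis
    using f(1) by (auto simp: prim_iff keys_basisv elim!: keys_linE split: if_splits)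
qed

text \<open>A projection onto the primitive elements is chosen in each degree separately, which
  makes the result graded. It fixes every primitive element because the homogeneous components of
  such an element are primitive again.\<close>

lemma graded_projection_exists:
  "\<exists>\<pi>. (\<forall>b. \<pi> b \<in> prim \<and> homog dg (dg b) (\<pi> b)) \<and> (\<forall>w\<in>prim. lin \<pi> w = w)"
proof -
  define V where "V d = {f \<in> prim. homog dg d f}" for d
  have V: "pm.subspace (V d)" for d
  proof -
    have "V d = prim \<inter> span_of {b. dg b = d}" by (auto simp: V_def homog_def span_of_def)
    then show ?thesis using pm.subspace_inter[OF subspace_prim subspace_span_of] by simp
  qed
  \<comment> \<open>A linear left inverse of the identity on \<open>V d\<close> with range in
    \<open>V d\<close> is a projection onto \<open>V d\<close>.\<close>
  have "\<exists>g. range g \<subseteq> V d \<and> Vector_Spaces.linear scal scal g \<and> (\<forall>v\<in>V d. g v = v)" for d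
    using pm_pair.linear_exists_left_inverse_on[OF pm.linear_id V[of d]] by auto
  then obtain p where p: "\<And>d. range (p d) \<subseteq> V d" "\<And>d. Vector_Spaces.linear scal scal (p d)"
      "\<And>d v. v \<in> V d \<Longrightarrow> p d v = v"
    by metis
  have p_lin: "p d f = lin (\<lambda>b. p d (basisv b)) f" for d f
  proof -
    interpret Vector_Spaces.linear scal scal "p d" by (rule p)
    have "p d f = p d (lin basisv f)" by simp
    also have "\<dots> = lin (\<lambda>b. p d (basisv b)) f"
      unfolding lin_def by (simp add: sum scale)
    finally show ?thesis .
  qed
  define \<pi> where "\<pi> b = p (dg b) (basisv b)" for b
  have "\<pi> b \<in> V (dg b)" for b using p(1) by (auto simp: \<pi>_def)
  moreover have "lin \<pi> w = w" if w: "w \<in> prim" for w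
  proof -
    define h where "h d = lin (\<lambda>b. if dg b = d then basisv b else 0) w" for d
    have hV: "h d \<in> V d" for d
      using homog_component_prim[OF w, of d]
      by (auto simp: V_def h_def homog_def keys_basisv elim!: keys_linE split: if_splits)
    have "lin \<pi> (h d) = h d" for d
    proof -
      have "lin \<pi> (h d) = lin (\<lambda>b. p d (basisv b)) (h d)"
        by (rule lin_cong) (use hV[of d] in \<open>auto simp: V_def homog_def \<pi>_def\<close>)
      also have "\<dots> = p d (h d)" by (rule p_lin[symmetric])
      also have "\<dots> = h d" by (rule p(3)[OF hV])
      finally show ?thesis .
    qed
    moreover have "w = (\<Sum>d\<in>dg ` Poly_Mapping.keys w. h d)"
    proof -
      have "lin basisv w = lin (\<lambda>b. \<Sum>d\<in>dg ` Poly_Mapping.keys w. if dg b = d then basisv b else 0) w"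
        by (rule lin_cong) simp
      then show ?thesis unfolding lin_fun_sum lin_id h_def .
    qed
    ultimately show ?thesis
      using lin_sum[of \<pi> h "dg ` Poly_Mapping.keys w"] by simp
  qed
  ultimately show ?thesis by (auto simp: V_def)
qed

section \<open>Symmetry and refinement of iterated coproducts\<close>

lemma swap_invariant_D:
  assumes "m \<in> M"
  shows "swap_invariant (D n m)"
  unfolding swap_invariant_def
proof
  fix k
  show "lin (under k swapv) (D n m) = D n m"
  proof (cases "k + 2 \<le> n")
    case True
    then obtain j where "n = k + Suc (Suc j)" using le_Suc_ex[of "k + 2" n] by auto
    then show ?thesis using lin_under_D[OF assms lin_swapv_D] by simp
  next
    case False
    \<comment> \<open>At most one letter stands behind position \<open>k\<close>, so there is
      nothing to swap.\<close>
    have "lin (under k swapv) (D n m) = lin basisv (D n m)"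
    proof (rule lin_cong)
      fix l assume "l \<in> Poly_Mapping.keys (D n m)"
      then have "length (drop k l) \<le> 1" using False length_D[OF assms] by fastforce
      then have "swap2 (drop k l) = drop k l" by (cases "drop k l" rule: swap2.cases) auto
      then show "under k swapv l = basisv l" by (simp add: under_def)
    qed
    then show ?thesis by simp
  qed
qed

fun rcomult_hd :: "'b list \<Rightarrow> ('b list \<Rightarrow>\<^sub>0 'k)" where
  "rcomult_hd [] = 0"
| "rcomult_hd (a # l) = lin (\<lambda>p. basisv (fst p # snd p # l)) (rcomult a)"

lemma lin_rcomult_hd_D:
  assumes "m \<in> M"
  shows "lin rcomult_hd (D (Suc j) m) = D (Suc (Suc j)) m"
proof -
  have "rcomult u = 0" by (simp add: rcomult_def comult_unit)
  then have "lin rcomult_hd (D (Suc j) m) =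
      lin (\<lambda>p. lin (\<lambda>l. lin (\<lambda>q. basisv (fst q # snd q # l)) (rcomult (fst p))) (D j (snd p))) (\<Delta> m)"
    unfolding D.simps lin_lin by (intro lin_cong) auto
  also have "\<dots> = D (Suc (Suc j)) m"
    unfolding D_Suc_Suc[OF assms]
    by (subst lin_commute) (auto intro!: lin_cong simp: lin_rcomult if_distrib[of "lin _"])
  finally show ?thesis .
qed

text \<open>Coassociativity in reduced form: splitting any one factor once more produces the same
  tensor. Hence vanishing of the next iterate makes this one vanish under the reduced coproduct in
  each factor.\<close>

lemma lin_under_rcomult_D:
  assumes "m \<in> M" "k < n"
  shows "lin (under k rcomult_hd) (D n m) = D (Suc n) m"
proof -
  obtain j where "n = k + Suc j" using assms(2) less_iff_Suc_add by auto
  then show ?thesis using lin_under_D[OF assms(1) lin_rcomult_hd_D, of k j] by simp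
qed

section \<open>Products with a primitive left factor\<close>

text \<open>Left multiplication by \<open>a\<close> extended to words as a derivation: each term
  multiplies \<open>a\<close> into one letter, and the empty word has no terms.\<close>

fun insert_mul :: "'b \<Rightarrow> 'b list \<Rightarrow> ('b list \<Rightarrow>\<^sub>0 'k)" where
  "insert_mul a [] = 0"
| "insert_mul a (b # l) = basisv (mul a b # l) + lin (\<lambda>l'. basisv (b # l')) (insert_mul a l)"

definition mulv :: "('b \<Rightarrow>\<^sub>0 'k) \<Rightarrow> ('b \<Rightarrow>\<^sub>0 'k) \<Rightarrow> ('b \<Rightarrow>\<^sub>0 'k)" where
  "mulv f g = lin (\<lambda>a. lin (\<lambda>b. basisv (mul a b)) g) f"

text \<open>Compatibility of product and coproduct, with the coproduct of \<open>w\<close> replaced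
  by its two primitive terms; in each of them the unit drops out of one factor.\<close>

lemma comult_mul_prim:
  assumes w: "w \<in> prim" and m: "m \<in> M"
  shows "lin (\<lambda>a. \<Delta> (mul a m)) w =
    lin (\<lambda>a. lin (\<lambda>q. basisv (mul a (fst q), snd q)) (\<Delta> m)) w +
    lin (\<lambda>a. lin (\<lambda>q. basisv (fst q, mul a (snd q))) (\<Delta> m)) w"
proof -
  have wM: "a \<in> M" if "a \<in> Poly_Mapping.keys w" for a
    using w that by (auto simp: prim_iff)
  let ?g = "\<lambda>p. lin (\<lambda>q. basisv (mul (fst p) (fst q), mul (snd p) (snd q))) (\<Delta> m)"
  have "lin (\<lambda>a. \<Delta> (mul a m)) w = lin ?g (lin \<Delta> w)"
    unfolding lin_lin by (rule lin_cong) (use wM m comult_mul in auto)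
  also have "\<dots> = lin (\<lambda>b. ?g (b, u)) w + lin (\<lambda>b. ?g (u, b)) w"
    using w by (simp add: prim_iff)
  also have "lin (\<lambda>b. ?g (b, u)) w = lin (\<lambda>a. lin (\<lambda>q. basisv (mul a (fst q), snd q)) (\<Delta> m)) w"
    by (intro lin_cong) (use comult_keys[OF m] mul_unit_left in auto)
  also have "lin (\<lambda>b. ?g (u, b)) w = lin (\<lambda>a. lin (\<lambda>q. basisv (fst q, mul a (snd q))) (\<Delta> m)) w"
    by (intro lin_cong) (use comult_keys[OF m] mul_unit_left in auto)
  finally show ?thesis .
qed

text \<open>A primitive factor either becomes a tensor factor of its own, which inserts it into
  \<open>D k m\<close> with \<open>n = Suc k\<close>, or multiplies one factor of
  \<open>D n m\<close>. The equation is summed over \<open>w\<close>, since a single basis element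
  \<open>a\<close> need not be primitive.\<close>

lemma D_mul_prim:
  assumes w: "w \<in> prim" and "m \<in> M"
  shows "lin (\<lambda>a. D n (mul a m)) w =
    lin (\<lambda>a. (case n of 0 \<Rightarrow> 0 | Suc k \<Rightarrow> lin (ins a) (D k m)) + lin (insert_mul a) (D n m)) w"
  using \<open>m \<in> M\<close>
proof (induction n arbitrary: m)
  case 0
  have wM: "a \<in> M" "a \<noteq> u" if "a \<in> Poly_Mapping.keys w" for a
    using w that by (auto simp: prim_iff)
  have "lin (\<lambda>a. D 0 (mul a m)) w = lin (\<lambda>a. 0) w"
    by (rule lin_cong) (use wM mul_eq_unit 0 in auto)
  also have "\<dots> = lin (\<lambda>a. 0 + lin (insert_mul a) (D 0 m)) w"
    by (rule lin_cong) auto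
  finally show ?case by simp
next
  case (Suc n)
  have wM: "a \<in> M" "a \<noteq> u" if "a \<in> Poly_Mapping.keys w" for a
    using w that by (auto simp: prim_iff)
  let ?I = "\<lambda>n m a. case n of 0 \<Rightarrow> 0 | Suc k \<Rightarrow> lin (ins a) (D k m)"
  let ?h = "\<lambda>p. if fst p = u then 0 else lin (\<lambda>l. basisv (fst p # l)) (D n (snd p))"
  have "lin (\<lambda>a. D (Suc n) (mul a m)) w = lin ?h (lin (\<lambda>a. \<Delta> (mul a m)) w)"
    by simp
  also have "\<dots> = lin (\<lambda>a. lin (\<lambda>q. ?h (mul a (fst q), snd q)) (\<Delta> m)) w +
      lin (\<lambda>q. lin (\<lambda>a. ?h (fst q, mul a (snd q))) w) (\<Delta> m)"
    unfolding comult_mul_prim[OF w Suc.prems]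
    by (subst (2) lin_commute) simp
  also have "lin (\<lambda>a. lin (\<lambda>q. ?h (mul a (fst q), snd q)) (\<Delta> m)) w =
      lin (\<lambda>a. lin (\<lambda>l. basisv (a # l)) (D n m) + lin (\<lambda>q. if fst q = u then 0 else
        lin (\<lambda>l. basisv (mul a (fst q) # l)) (D n (snd q))) (\<Delta> m)) w"
  proof (rule lin_cong)
    fix a assume a: "a \<in> Poly_Mapping.keys w"
    \<comment> \<open>If the first factor of the coproduct of \<open>m\<close> is \<open>u\<close>,
      then \<open>mul a u = a\<close> becomes a letter by itself; otherwise \<open>a\<close> is
      multiplied into the first letter.\<close>
    have "lin (\<lambda>q. ?h (mul a (fst q), snd q)) (\<Delta> m) =
      lin (\<lambda>q. (if fst q = u then lin (\<lambda>l. basisv (a # l)) (D n (snd q)) else 0) +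
        (if fst q = u then 0 else lin (\<lambda>l. basisv (mul a (fst q) # l)) (D n (snd q)))) (\<Delta> m)"
      by (intro lin_cong) (use wM[OF a] comult_keys[OF Suc.prems] mul_eq_unit mul_unit_right in auto)
    also have "\<dots> = lin (\<lambda>l. basisv (a # l)) (D n m) + lin (\<lambda>q. if fst q = u then 0 else
        lin (\<lambda>l. basisv (mul a (fst q) # l)) (D n (snd q))) (\<Delta> m)"
      unfolding lin_fun_add by (subst counit_left'[OF Suc.prems]) simp
    finally show "lin (\<lambda>q. ?h (mul a (fst q), snd q)) (\<Delta> m) =
      lin (\<lambda>l. basisv (a # l)) (D n m) + lin (\<lambda>q. if fst q = u then 0 else
        lin (\<lambda>l. basisv (mul a (fst q) # l)) (D n (snd q))) (\<Delta> m)" .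
  qed
  \<comment> \<open>Here \<open>a\<close> multiplies the second half, to which the induction
    hypothesis applies; the first letter stays.\<close>
  also have "lin (\<lambda>q. lin (\<lambda>a. ?h (fst q, mul a (snd q))) w) (\<Delta> m) =
    lin (\<lambda>q. lin (\<lambda>a. if fst q = u then 0 else lin (\<lambda>l. basisv (fst q # l))
      (?I n (snd q) a + lin (insert_mul a) (D n (snd q)))) w) (\<Delta> m)"
  proof (rule lin_cong)
    fix q assume "q \<in> Poly_Mapping.keys (\<Delta> m)"
    then have "snd q \<in> M" using comult_keys Suc.prems by blast
    from arg_cong[OF Suc.IH[OF this], of "lin (\<lambda>l. basisv (fst q # l))"]
    show "lin (\<lambda>a. ?h (fst q, mul a (snd q))) w = lin (\<lambda>a. if fst q = u then 0 else lin (\<lambda>l. basisv (fst q # l))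
      (?I n (snd q) a + lin (insert_mul a) (D n (snd q)))) w"
      by (cases "fst q = u") (simp_all del: lin_add)
  qed
  also have "\<dots> = lin (\<lambda>a. lin (\<lambda>q. if fst q = u then 0 else lin (\<lambda>l. basisv (fst q # l))
      (?I n (snd q) a + lin (insert_mul a) (D n (snd q)))) (\<Delta> m)) w"
    by (rule lin_commute)
  also have "lin (\<lambda>a. lin (\<lambda>l. basisv (a # l)) (D n m) + lin (\<lambda>q. if fst q = u then 0 else
        lin (\<lambda>l. basisv (mul a (fst q) # l)) (D n (snd q))) (\<Delta> m)) w + \<dots> =
    lin (\<lambda>a. ?I (Suc n) m a + lin (insert_mul a) (D (Suc n) m)) w"
    unfolding lin_fun_add[symmetric]
  proof (rule lin_cong)
    fix a
    \<comment> \<open>The recursion of \<open>ins\<close>: \<open>a\<close> stands in front of all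
      letters or behind the first one. For \<open>n = 0\<close> only the former is possible.\<close>
    have I: "?I (Suc n) m a = lin (\<lambda>l. basisv (a # l)) (D n m) +
      lin (\<lambda>q. if fst q = u then 0 else lin (\<lambda>l. basisv (fst q # l)) (?I n (snd q) a)) (\<Delta> m)"
    proof (cases n)
      case 0
      then show ?thesis by (auto cong: if_cong)
    next
      case (Suc k)
      have "lin (ins a) (D n m) = lin (\<lambda>q. (if fst q = u then 0 else lin (\<lambda>l. basisv (a # fst q # l)) (D k (snd q))) +
         (if fst q = u then 0 else lin (\<lambda>l. basisv (fst q # l)) (lin (ins a) (D k (snd q))))) (\<Delta> m)"
        unfolding Suc D.simps lin_lin by (rule lin_cong) (auto simp: lin_fun_add)
      then show ?thesis
        by (simp add: Suc lin_fun_add if_distrib[of "lin _"] cong: if_cong)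
    qed
    have S: "lin (insert_mul a) (D (Suc n) m) =
      lin (\<lambda>q. (if fst q = u then 0 else lin (\<lambda>l. basisv (mul a (fst q) # l)) (D n (snd q))) +
       (if fst q = u then 0 else lin (\<lambda>l. basisv (fst q # l)) (lin (insert_mul a) (D n (snd q))))) (\<Delta> m)"
      unfolding D.simps lin_lin by (rule lin_cong) (auto simp: lin_fun_add)
    have R: "lin (\<lambda>q. if fst q = u then 0 else lin (\<lambda>l. basisv (fst q # l))
         (?I n (snd q) a + lin (insert_mul a) (D n (snd q)))) (\<Delta> m) =
       lin (\<lambda>q. if fst q = u then 0 else lin (\<lambda>l. basisv (fst q # l)) (?I n (snd q) a)) (\<Delta> m) +
       lin (\<lambda>q. if fst q = u then 0 else lin (\<lambda>l. basisv (fst q # l)) (lin (insert_mul a) (D n (snd q)))) (\<Delta> m)"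
      unfolding lin_fun_add[symmetric] by (rule lin_cong) auto
    show "lin (\<lambda>l. basisv (a # l)) (D n m) + lin (\<lambda>q. if fst q = u then 0 else
        lin (\<lambda>l. basisv (mul a (fst q) # l)) (D n (snd q))) (\<Delta> m) +
      lin (\<lambda>q. if fst q = u then 0 else lin (\<lambda>l. basisv (fst q # l))
         (?I n (snd q) a + lin (insert_mul a) (D n (snd q)))) (\<Delta> m) =
      ?I (Suc n) m a + lin (insert_mul a) (D (Suc n) m)"
      unfolding I S R lin_fun_add by (simp only: add_ac)
  qed
  finally show ?case .
qed

section \<open>Nested products of primitive elements\<close>

text \<open>The right-nested product. Starting the fold at \<open>u\<close> sends the empty word to
  the unit and a single letter from \<open>M\<close> to itself.\<close>

abbreviation nest :: "'b list \<Rightarrow> ('b \<Rightarrow>\<^sub>0 'k)" where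
  "nest l \<equiv> basisv (foldr mul l u)"

lemma nest_in: "set l \<subseteq> M \<Longrightarrow> foldr mul l u \<in> M"
  by (induction l) (auto simp: unit_in mul_in)

lemma keys_tensor_list_in:
  assumes "set ws \<subseteq> span_of B" and l: "l \<in> Poly_Mapping.keys (tensor_list ws :: 'b list \<Rightarrow>\<^sub>0 'k)"
  shows "set l \<subseteq> B \<and> length l = length ws"
  using keys_tensor_list[OF l] assms(1)
  by (induction rule: list_all2_induct) (auto simp: span_of_def)

lemma D_mulv:
  assumes "w \<in> prim" "Poly_Mapping.keys x \<subseteq> M"
  shows "lin (D (Suc n)) (mulv w x) =
    lin (\<lambda>a. lin (ins a) (lin (D n) x) + lin (insert_mul a) (lin (D (Suc n)) x)) w"
proof -
  have "lin (D (Suc n)) (mulv w x) = lin (\<lambda>m. lin (\<lambda>a. D (Suc n) (mul a m)) w) x"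
    unfolding mulv_def lin_lin lin_basisv by (rule lin_commute)
  also have "\<dots> = lin (\<lambda>m. lin (\<lambda>a. lin (ins a) (D n m) + lin (insert_mul a) (D (Suc n) m)) w) x"
    by (rule lin_cong) (use assms D_mul_prim[of w _ "Suc n"] in \<open>auto simp del: D.simps\<close>)
  also have "\<dots> = lin (\<lambda>a. lin (\<lambda>m. lin (ins a) (D n m) + lin (insert_mul a) (D (Suc n) m)) x) w"
    by (rule lin_commute)
  finally show ?thesis by (simp add: lin_fun_add del: D.simps)
qed

lemma lin_nest_Cons: "lin nest (tensor_list (w # ws)) = mulv w (lin nest (tensor_list ws))"
  by (simp add: mulv_def)

text \<open>Both claims go through one induction: in \<open>D_mulv\<close> the
  \<open>insert_mul\<close> term involves an iterate of order beyond the length of \<open>ws\<close>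
  and vanishes by the second claim. Only the insertion of \<open>w\<close> remains, as in the
  recursion of \<open>symmetrize\<close>.\<close>

lemma D_nest_tensor_list:
  assumes "set ws \<subseteq> prim"
  shows "lin (D (length ws)) (lin nest (tensor_list ws)) = lin symmetrize (tensor_list ws)"
    and "length ws < n \<Longrightarrow> lin (D n) (lin nest (tensor_list ws)) = 0"
  using assms
proof (induction ws arbitrary: n)
  case Nil
  { case 1 then show ?case by simp }
  { case 2 then show ?case by (cases n) (auto simp: comult_unit) }
next
  case (Cons w ws)
  have keys: "Poly_Mapping.keys (lin nest (tensor_list ws)) \<subseteq> M" if "set ws \<subseteq> prim"
  proof -
    have "set ws \<subseteq> span_of M" using that by (auto simp: prim_def)
    from keys_tensor_list_in[OF this] show ?thesis
      by (auto simp: keys_basisv nest_in elim!: keys_linE)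
  qed
  { case 1
    then have "lin (D (length (w # ws))) (lin nest (tensor_list (w # ws))) =
      lin (\<lambda>a. lin (ins a) (lin symmetrize (tensor_list ws))) w"
      unfolding lin_nest_Cons length_Cons
      by (subst D_mulv) (use keys Cons.IH in \<open>auto simp del: D.simps lin_lin\<close>)
    then show ?case by simp }
  { case 2
    then obtain k where n: "n = Suc k" by (cases n) auto
    with 2 show ?case
      unfolding lin_nest_Cons n
      by (subst D_mulv) (use keys Cons.IH in \<open>auto simp del: D.simps lin_lin\<close>) }
qed

lemma tens_power_eq_span:
  "tens_power prim n = pm.span {tensor_list ws | ws. length ws = n \<and> set ws \<subseteq> prim}"
  by (simp add: tens_power_def lin_span_eq_span)

lemma keys_tens_power:
  assumes "z \<in> tens_power prim n"
  shows "Poly_Mapping.keys z \<subseteq> {l. set l \<subseteq> M \<and> length l = n}"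
proof -
  have "tens_power prim n \<subseteq> span_of {l. set l \<subseteq> M \<and> length l = n}"
    unfolding tens_power_eq_span
  proof (rule pm.span_minimal[OF _ subspace_span_of], rule subsetI)
    fix y :: "'b list \<Rightarrow>\<^sub>0 'k"
    assume "y \<in> {tensor_list ws | ws. length ws = n \<and> set ws \<subseteq> prim}"
    then obtain ws where ws: "y = tensor_list ws" "length ws = n" "set ws \<subseteq> span_of M"
      by (auto simp: prim_def)
    from keys_tensor_list_in[OF ws(3)] ws
    show "y \<in> span_of {l. set l \<subseteq> M \<and> length l = n}" by (auto simp: span_of_def)
  qed
  with assms have "z \<in> span_of {l. set l \<subseteq> M \<and> length l = n}" by blast
  then show ?thesis by (simp add: span_of_def)
qed

lemma D_nest:
  assumes "z \<in> tens_power prim n"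
  shows "lin (D n) (lin nest z) = lin symmetrize z"
    and "n < k \<Longrightarrow> lin (D k) (lin nest z) = 0"
proof -
  have sub: "pm.subspace {z. lin (D n) (lin nest z) = lin symmetrize z \<and>
      (\<forall>k>n. lin (D k) (lin nest z) = 0)}"
    unfolding pm.subspace_def by (simp del: lin_lin)
  have "tens_power prim n \<subseteq> {z. lin (D n) (lin nest z) = lin symmetrize z \<and>
      (\<forall>k>n. lin (D k) (lin nest z) = 0)}"
    unfolding tens_power_eq_span
    by (rule pm.span_minimal[OF _ sub]) (use D_nest_tensor_list in \<open>auto simp del: lin_lin\<close>)
  then show "lin (D n) (lin nest z) = lin symmetrize z" "n < k \<Longrightarrow> lin (D k) (lin nest z) = 0"
    using assms by blast+
qed

end

section \<open>A fixed graded projection and its tensor powers\<close>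

locale projected_magma_coalgebra = connected_magma_coalgebra +
  fixes \<pi> :: "'a \<Rightarrow> ('a \<Rightarrow>\<^sub>0 'b)"
  assumes proj_in_prim: "\<pi> b \<in> prim"
    and proj_homog: "homog dg (dg b) (\<pi> b)"
    and proj_prim: "w \<in> prim \<Longrightarrow> lin \<pi> w = w"
begin

fun proj_hd :: "'a list \<Rightarrow> ('a list \<Rightarrow>\<^sub>0 'b)" where
  "proj_hd [] = basisv []"
| "proj_hd (a # l) = lin (\<lambda>a'. basisv (a' # l)) (\<pi> a)"

abbreviation P :: "'a list \<Rightarrow> ('a list \<Rightarrow>\<^sub>0 'b)" where
  "P l \<equiv> tensor_list (map \<pi> l)"

lemma keys_P:
  assumes "l' \<in> Poly_Mapping.keys (P l)"
  shows "length l' = length l \<and> sum_list (map dg l') = sum_list (map dg l)"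
proof -
  from keys_tensor_list[OF assms] have "list_all2 (\<lambda>b a. b \<in> Poly_Mapping.keys (\<pi> a)) l' l"
    by (simp add: list_all2_map2)
  then show ?thesis
    by (induction rule: list_all2_induct) (use proj_homog in \<open>auto simp: homog_def\<close>)
qed

text \<open>The slice of \<^term>\<open>z\<close> through the \<^term>\<open>k\<close>-th tensor factor, with all other factors fixed, is
  annihilated by the reduced coproduct, hence primitive.\<close>

lemma lin_under_proj_hd:
  assumes z: "\<And>l. l \<in> Poly_Mapping.keys z \<Longrightarrow> length l = n \<and> set l \<subseteq> M - {u}"
    and k: "k < n" and ker: "lin (under k rcomult_hd) z = 0"
  shows "lin (under k proj_hd) z = z"
proof (rule poly_mapping_eqI)
  fix l0 :: "'a list"
  \<comment> \<open>\<open>sl\<close> reads off the letter at position \<open>k\<close> from the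
    words that agree with \<open>l0\<close> elsewhere. \<open>sl2\<close> does this for the pair at
    \<open>k\<close> and \<open>Suc k\<close> after one factor has been split, so its words are one
    letter longer and are compared after dropping \<open>Suc (Suc k)\<close> letters.\<close>
  define sl where "sl l = (if take k l = take k l0 \<and> drop (Suc k) l = drop (Suc k) l0
    then basisv (l ! k) else 0 :: 'a \<Rightarrow>\<^sub>0 'b)" for l
  define sl2 where "sl2 l = (if take k l = take k l0 \<and> drop (Suc (Suc k)) l = drop (Suc k) l0
    then basisv (l ! k, l ! Suc k) else 0 :: 'a \<times> 'a \<Rightarrow>\<^sub>0 'b)" for l
  have split: "\<exists>p a q. l = p @ a # q \<and> length p = k" if "length l = n" for l :: "'a list"
    using k that by (intro exI[of _ "take k l"] exI[of _ "l ! k"] exI[of _ "drop (Suc k) l"])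
      (simp add: id_take_nth_drop[symmetric])
  have len: "length l = n" if "l \<in> Poly_Mapping.keys (lin (under k proj_hd) z)" for l
  proof -
    from that obtain l' where l': "l' \<in> Poly_Mapping.keys z" "l \<in> Poly_Mapping.keys (under k proj_hd l')"
      by (auto elim!: keys_linE)
    then obtain p a q where "l' = p @ a # q" "length p = k" "length l' = n" using split z by blast
    then show ?thesis using l'(2) by (auto simp: under_append keys_basisv elim!: keys_linE)
  qed
  show "Poly_Mapping.lookup (lin (under k proj_hd) z) l0 = Poly_Mapping.lookup z l0"
  proof (cases "length l0 = n")
    case False
    then show ?thesis using len z by (metis not_in_keys_iff_lookup_eq_zero)
  next
    case True
    then obtain p0 a0 q0 where l0: "l0 = p0 @ a0 # q0" "length p0 = k" using split by blast
    have lookup_sl: "Poly_Mapping.lookup (lin sl y) a0 = Poly_Mapping.lookup y l0"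
      if y: "\<And>l. l \<in> Poly_Mapping.keys y \<Longrightarrow> length l = n" for y
    proof -
      have "Poly_Mapping.lookup (lin sl y) a0 = Poly_Mapping.lookup (lin basisv y) l0"
        unfolding lookup_lin
      proof (rule sum.cong[OF refl])
        fix l assume "l \<in> Poly_Mapping.keys y"
        then obtain p a q where "l = p @ a # q" "length p = k" using split y by blast
        then show "Poly_Mapping.lookup y l * Poly_Mapping.lookup (sl l) a0 =
            Poly_Mapping.lookup y l * Poly_Mapping.lookup (basisv l) l0"
          by (auto simp: l0 sl_def lookup_basisv nth_append)
      qed
      then show ?thesis by simp
    qed
    have "lin sl z \<in> prim"
    proof (rule prim_if_lin_rcomult_eq_0)
      show "Poly_Mapping.keys (lin sl z) \<subseteq> M - {u}"
      proof
        fix b assume "b \<in> Poly_Mapping.keys (lin sl z)"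
        then obtain l where "l \<in> Poly_Mapping.keys z" "b = l ! k"
          by (auto simp: sl_def keys_basisv elim!: keys_linE split: if_splits)
        then show "b \<in> M - {u}" using z k nth_mem by blast
      qed
      have "lin rcomult (lin sl z) = lin sl2 (lin (under k rcomult_hd) z)"
        unfolding lin_lin
      proof (rule lin_cong)
        fix l assume "l \<in> Poly_Mapping.keys z"
        then obtain p a q where "l = p @ a # q" "length p = k" using split z by blast
        then show "lin rcomult (sl l) = lin sl2 (under k rcomult_hd l)"
          by (auto simp: sl_def sl2_def under_append l0 nth_append)
      qed
      then show "lin rcomult (lin sl z) = 0" by (simp add: ker)
    qed
    \<comment> \<open>Slicing commutes with the projection of factor \<open>k\<close>, and the
      projection fixes the primitive slice; so both tensors have the same slice.\<close>
    from proj_prim[OF this] have "lin sl z = lin sl (lin (under k proj_hd) z)"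
    proof (elim trans[OF sym], unfold lin_lin, intro lin_cong)
      fix l assume "l \<in> Poly_Mapping.keys z"
      then obtain p a q where "l = p @ a # q" "length p = k" using split z by blast
      then show "lin \<pi> (sl l) = lin sl (under k proj_hd l)"
        by (auto simp: sl_def under_append l0 nth_append)
    qed
    then show ?thesis using lookup_sl[of z] lookup_sl[of "lin (under k proj_hd) z"] z len by simp
  qed
qed

text \<open>\<open>P\<close> is the composite of the projections at the single positions, each of
  which fixes \<open>z\<close> by \<open>lin_under_proj_hd\<close>. The induction runs down from
  \<open>k = n\<close>.\<close>

lemma lin_P_if_kernel:
  assumes z: "\<And>l. l \<in> Poly_Mapping.keys z \<Longrightarrow> length l = n \<and> set l \<subseteq> M - {u}"
    and ker: "\<And>k. k < n \<Longrightarrow> lin (under k rcomult_hd) z = 0"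
  shows "lin P z = z"
proof -
  have len: "l \<in> Poly_Mapping.keys z \<Longrightarrow> length l = n" for l using z by blast
  have "lin (under k P) z = z" if "k \<le> n" for k
    using that
  proof (induction "n - k" arbitrary: k)
    case 0
    then have "k = n" by simp
    then show ?case using lin_under_full[of z n P] len by simp
  next
    case (Suc d)
    then have k: "k < n" by simp
    have "lin (under k P) z = lin (under k (\<lambda>l. lin (under_hd P) (proj_hd l))) z"
      by (rule lin_under_cong[OF len k]) auto
    also have "\<dots> = lin (under (Suc k) P) (lin (under k proj_hd) z)"
      unfolding lin_lin
    proof (rule lin_cong)
      fix l assume "l \<in> Poly_Mapping.keys z"
      then have l: "length l = n" by (rule len)
      have "lin (under (Suc k) P) (under k proj_hd l) = lin (under k (under_hd P)) (under k proj_hd l)"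
      proof (rule lin_cong, rule under_Suc)
        fix l' assume "l' \<in> Poly_Mapping.keys (under k proj_hd l)"
        moreover have "drop k l \<noteq> []" using l k by simp
        ultimately show "k < length l'"
          using l k by (cases "drop k l") (auto simp: under_def keys_basisv elim!: keys_linE)
      qed
      then show "under k (\<lambda>l. lin (under_hd P) (proj_hd l)) l = lin (under (Suc k) P) (under k proj_hd l)"
        using l k by (simp add: lin_under)
    qed
    also have "lin (under k proj_hd) z = z"
      by (rule lin_under_proj_hd[OF z k ker[OF k]])
    also have "lin (under (Suc k) P) z = z"
      using Suc by (intro Suc.hyps) auto
    finally show ?case .
  qed
  from this[of 0] show ?thesis by (simp add: under_0)
qed

lemma P_append: "P (l @ l') = lin (\<lambda>k. lin (\<lambda>k'. basisv (k @ k')) (P l')) (P l)"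
  by (simp add: tensor_list_append)

text \<open>The same map acts on every factor, so it commutes with exchanging two of them.\<close>

lemma lin_under_swapv_P: "lin (under k swapv) (P l) = lin P (under k swapv l)"
proof (cases "k \<le> length l")
  case True
  then obtain p q where l: "l = p @ q" "length p = k" by (rule list_split_at)
  have swap: "lin swapv (P q) = P (swap2 q)"
  proof (cases q rule: swap2.cases)
    case (1 a b r)
    then show ?thesis by simp (rule lin_commute)
  qed auto
  have "lin (under k swapv) (P l) =
      lin (\<lambda>p'. lin (\<lambda>q'. basisv (p' @ q')) (lin swapv (P q))) (P p)"
    unfolding l(1) P_append lin_lin
    by (intro lin_cong) (use keys_P l(2) in \<open>auto simp: under_append\<close>)
  also have "\<dots> = lin P (under k swapv l)"
    unfolding swap by (simp add: l under_append tensor_list_append)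
  finally show ?thesis .
next
  case False
  have "lin (under k swapv) (P l) = lin basisv (P l)"
    by (rule lin_cong) (use keys_P[of _ l] False in \<open>auto simp: under_def\<close>)
  then show ?thesis using False by (simp add: under_def)
qed

lemma swap_invariant_lin_P:
  assumes "swap_invariant z"
  shows "swap_invariant (lin P z)"
  unfolding swap_invariant_def
proof
  fix k
  have "lin (under k swapv) (lin P z) = lin P (lin (under k swapv) z)"
    by (simp add: lin_under_swapv_P)
  then show "lin (under k swapv) (lin P z) = lin P z"
    using assms by (simp add: swap_invariant_def del: lin_lin)
qed

section \<open>The morphism and its length components\<close>

text \<open>Stopping at \<open>dg m\<close> loses nothing, as all later iterates vanish by
  \<open>D_eq_0\<close>.\<close>

definition \<phi> :: "'a \<Rightarrow> ('a list \<Rightarrow>\<^sub>0 'b)" where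
  "\<phi> m = (\<Sum>n\<le>dg m. lin P (D n m))"

lemma keys_lin_P_D:
  assumes "m \<in> M" "l \<in> Poly_Mapping.keys (lin P (D n m))"
  shows "length l = n \<and> sum_list (map dg l) = dg m"
  using assms(2) keys_P keys_D[OF assms(1)] by (fastforce elim!: keys_linE)

lemma homog_lin_\<phi>:
  assumes "f \<in> span_of M" "homog dg d f"
  shows "homog (\<lambda>l. sum_list (map dg l)) d (lin \<phi> f)"
  unfolding homog_def
proof
  fix l assume "l \<in> Poly_Mapping.keys (lin \<phi> f)"
  then obtain m where m: "m \<in> Poly_Mapping.keys f" "l \<in> Poly_Mapping.keys (\<phi> m)"
    by (rule keys_linE)
  then obtain n where "l \<in> Poly_Mapping.keys (lin P (D n m))"
    unfolding \<phi>_def using Poly_Mapping.keys_sum[of "\<lambda>n. lin P (D n m)" "{..dg m}"] by auto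
  then show "sum_list (map dg l) = d"
    using keys_lin_P_D m(1) assms by (auto simp: span_of_def homog_def)
qed

lemma len_part_\<phi>:
  assumes "f \<in> span_of M"
  shows "len_part n (lin \<phi> f) = lin P (lin (D n) f)"
  unfolding len_part_def lin_lin
proof (rule lin_cong)
  fix m assume "m \<in> Poly_Mapping.keys f"
  then have m: "m \<in> M" using assms by (auto simp: span_of_def)
  have "len_part n (\<phi> m) = (\<Sum>k\<le>dg m. len_part n (lin P (D k m)))"
    by (simp add: len_part_def \<phi>_def lin_sum)
  also have "\<dots> = (\<Sum>k\<le>dg m. if n = k then lin P (D k m) else 0)"
    by (intro sum.cong refl len_part_eq) (use keys_lin_P_D[OF m] in blast)
  \<comment> \<open>For \<open>n > dg m\<close> the index is missing from the sum, but then
    \<open>D n m\<close> vanishes too.\<close>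
  also have "\<dots> = lin P (D n m)"
    using D_eq_0[OF m, of n] by (auto simp: sum.delta not_le)
  finally show "lin (\<lambda>l. if length l = n then basisv l else 0) (\<phi> m) = lin P (D n m)"
    by (simp add: len_part_def)
qed

lemma keys_lin_D:
  assumes "f \<in> span_of M" "l \<in> Poly_Mapping.keys (lin (D n) f)"
  shows "length l = n \<and> set l \<subseteq> M - {u}"
  using assms keys_D by (force simp: span_of_def elim!: keys_linE)

lemma swap_invariant_lin_D:
  assumes "f \<in> span_of M"
  shows "swap_invariant (lin (D n) f)"
  unfolding swap_invariant_def lin_lin
  by (intro allI lin_cong)
    (use assms swap_invariant_D in \<open>auto simp: swap_invariant_def span_of_def\<close>)

lemma lin_P_in_tens_power:
  assumes "\<And>l. l \<in> Poly_Mapping.keys z \<Longrightarrow> length l = n"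
  shows "lin P z \<in> tens_power prim n"
  unfolding tens_power_eq_span
proof (rule lin_in_subspace[OF pm.subspace_span], rule pm.span_base)
  fix l assume "l \<in> Poly_Mapping.keys z"
  then have "length (map \<pi> l) = n" "set (map \<pi> l) \<subseteq> prim" using assms proj_in_prim by auto
  then show "P l \<in> {tensor_list ws | ws. length ws = n \<and> set ws \<subseteq> prim}" by blast
qed

lemma sym_tens_iff:
  "z \<in> sym_tens prim n \<longleftrightarrow> z \<in> tens_power prim n \<and> swap_invariant z"
  using swap_invariant_iff[of z n] keys_tens_power[of z n] by (auto simp: sym_tens_def)

lemma \<phi>_in_sym_coalg:
  assumes f: "f \<in> span_of M"
  shows "lin \<phi> f \<in> sym_coalg prim"
proof -
  have "lin P (lin (D n) f) \<in> tens_power prim n" for n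
    by (rule lin_P_in_tens_power) (use keys_lin_D[OF f] in blast)
  then show ?thesis
    using swap_invariant_lin_P[OF swap_invariant_lin_D[OF f]]
    by (simp add: sym_coalg_def sym_tens_iff len_part_\<phi>[OF f] del: lin_lin)
qed

section \<open>Compatibility with deconcatenation\<close>

lemma deconc_P:
  "deconc (P l) = (\<Sum>i\<le>length l. tens (P (take i l)) (P (drop i l)))"
proof -
  have "deconc (P l) = lin (\<lambda>l'. \<Sum>i\<le>length l. basisv (take i l', drop i l')) (P l)"
    unfolding deconc_def by (rule lin_cong) (use keys_P in auto)
  also have "\<dots> = (\<Sum>i\<le>length l. lin (\<lambda>l'. basisv (take i l', drop i l')) (P l))"
    by (rule lin_fun_sum)
  also have "\<dots> = (\<Sum>i\<le>length l. tens (P (take i l)) (P (drop i l)))"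
  proof (rule sum.cong[OF refl])
    fix i assume i: "i \<in> {..length l}"
    have "P l = lin (\<lambda>k. lin (\<lambda>k'. basisv (k @ k')) (P (drop i l))) (P (take i l))"
      using P_append[of "take i l" "drop i l"] by simp
    also have "lin (\<lambda>l'. basisv (take i l', drop i l')) \<dots> = tens (P (take i l)) (P (drop i l))"
      unfolding tens_def lin_lin lin_basisv
    proof (intro lin_cong)
      fix k k' assume "k \<in> Poly_Mapping.keys (P (take i l))"
      then have "length k = i" using keys_P i by fastforce
      then show "basisv (take i (k @ k'), drop i (k @ k')) = (basisv (k, k') :: _ \<Rightarrow>\<^sub>0 'b)" by simp
    qed
    finally show "lin (\<lambda>l'. basisv (take i l', drop i l')) (P l) = tens (P (take i l)) (P (drop i l))" .
  qed
  finally show ?thesis .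
qed

text \<open>Cutting the words of \<open>D n m\<close> after \<open>i\<close> letters is, by
  \<open>D_add\<close>, the coproduct followed by the iterates of orders \<open>i\<close> and
  \<open>n - i\<close>; summing over \<open>n\<close> and \<open>i\<close> gives pairs of
  orders.\<close>

lemma deconc_\<phi>:
  assumes m: "m \<in> M"
  shows "deconc (\<phi> m) = lin (\<lambda>p. tens (\<phi> (fst p)) (\<phi> (snd p))) (\<Delta> m)"
proof -
  define T where "T p i j = tens (lin P (D i (fst p))) (lin P (D j (snd p)))" for p i j
  have "deconc (lin P (D n m)) = (\<Sum>i\<le>n. lin (\<lambda>p. T p i (n - i)) (\<Delta> m))" for n
  proof -
    have "deconc (lin P (D n m)) = lin (\<lambda>l. \<Sum>i\<le>n. tens (P (take i l)) (P (drop i l))) (D n m)"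
      unfolding deconc_def lin_lin
      by (rule lin_cong) (use deconc_P length_D[OF m] in \<open>auto simp: deconc_def\<close>)
    also have "\<dots> = (\<Sum>i\<le>n. lin (\<lambda>l. tens (P (take i l)) (P (drop i l))) (D n m))"
      by (rule lin_fun_sum)
    also have "\<dots> = (\<Sum>i\<le>n. lin (\<lambda>p. T p i (n - i)) (\<Delta> m))"
    proof (rule sum.cong[OF refl])
      fix i assume "i \<in> {..n}"
      then have n: "n = i + (n - i)" by simp
      have "lin (\<lambda>l. tens (P (take i l)) (P (drop i l))) (D (i + (n - i)) m) =
          lin (\<lambda>p. T p i (n - i)) (\<Delta> m)"
        unfolding D_add[OF m] T_def tens_lin lin_lin lin_basisv
      proof (intro lin_cong)
        fix p l l' assume "p \<in> Poly_Mapping.keys (\<Delta> m)" "l \<in> Poly_Mapping.keys (D i (fst p))"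
        then have "length l = i" using length_D comult_keys[OF m] by blast
        then show "tens (P (take i (l @ l'))) (P (drop i (l @ l'))) = tens (P l) (P l')" by simp
      qed
      then show "lin (\<lambda>l. tens (P (take i l)) (P (drop i l))) (D n m) = lin (\<lambda>p. T p i (n - i)) (\<Delta> m)"
        using n by simp
    qed
    finally show ?thesis .
  qed
  then have "deconc (\<phi> m) = (\<Sum>n\<le>dg m. \<Sum>i\<le>n. lin (\<lambda>p. T p i (n - i)) (\<Delta> m))"
    by (simp add: \<phi>_def deconc_def lin_sum)
  also have "\<dots> = lin (\<lambda>p. \<Sum>n\<le>dg m. \<Sum>i\<le>n. T p i (n - i)) (\<Delta> m)"
    by (simp add: lin_fun_sum)
  also have "\<dots> = lin (\<lambda>p. tens (\<phi> (fst p)) (\<phi> (snd p))) (\<Delta> m)"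
  proof (rule lin_cong)
    fix p assume "p \<in> Poly_Mapping.keys (\<Delta> m)"
    then have p: "fst p \<in> M" "snd p \<in> M" "dg (fst p) + dg (snd p) = dg m"
      using comult_keys[OF m] by auto
    have T0: "i \<le> dg (fst p) \<and> j \<le> dg (snd p)" if "T p i j \<noteq> 0" for i j
      using that p D_eq_0 by (auto simp: T_def simp flip: not_less)
    have "(\<Sum>n\<le>dg m. \<Sum>i\<le>n. T p i (n - i)) = (\<Sum>(i, j) | i + j \<le> dg m. T p i j)"
      by (rule sum.triangle_reindex_eq[symmetric])
    \<comment> \<open>The degrees of the two factors add up to \<open>dg m\<close>, so the triangle
      contains the rectangle; outside the rectangle one of the iterates is zero.\<close>
    also have "\<dots> = (\<Sum>(i, j)\<in>{..dg (fst p)} \<times> {..dg (snd p)}. T p i j)"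
    proof (rule sum.mono_neutral_right)
      show "finite {(i, j). i + j \<le> dg m}"
        by (rule finite_subset[of _ "{..dg m} \<times> {..dg m}"]) auto
    qed (use p T0 in auto)
    also have "\<dots> = tens (\<phi> (fst p)) (\<phi> (snd p))"
      by (simp add: \<phi>_def tens_sum T_def sum.cartesian_product)
    finally show "(\<Sum>n\<le>dg m. \<Sum>i\<le>n. T p i (n - i)) = tens (\<phi> (fst p)) (\<phi> (snd p))" .
  qed
  finally show ?thesis .
qed

section \<open>Injectivity\<close>

lemma D_1: "m \<in> M \<Longrightarrow> D (Suc 0) m = (if m = u then 0 else basisv [m])"
proof -
  assume m: "m \<in> M"
  have "D (Suc 0) m = lin (\<lambda>p. if snd p = u then if fst p = u then 0 else basisv [fst p] else 0) (\<Delta> m)"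
    unfolding D.simps by (rule lin_cong) auto
  then show ?thesis
    using counit_right'[OF m, of "\<lambda>a. if a = u then 0 else basisv [a]"] by simp
qed

lemma \<phi>_eq_0:
  assumes f: "f \<in> span_of M" and "lin \<phi> f = 0"
  shows "f = 0"
proof -
  have P0: "lin P (lin (D n) f) = 0" for n
    using len_part_\<phi>[OF f, of n] assms(2) by (simp add: len_part_def)
  \<comment> \<open>From \<open>N\<close> on all iterates vanish on the support of \<open>f\<close>;
    the descending induction starts there.\<close>
  obtain N where N: "\<And>m. m \<in> Poly_Mapping.keys f \<Longrightarrow> dg m < N"
    using finite_keys[of f] finite_nat_set_iff_bounded[of "dg ` Poly_Mapping.keys f"] by auto
  have Dn: "lin (D n) f = 0" for n
  proof (induction "N - n" arbitrary: n)
    case 0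
    then have "lin (D n) f = lin (\<lambda>_. 0) f"
      using N f by (intro lin_cong D_eq_0) (fastforce simp: span_of_def)+
    then show ?case by simp
  next
    case (Suc d)
    then have D_Suc: "lin (D (Suc n)) f = 0" by simp
    \<comment> \<open>Vanishing of the next iterate makes the slices of this one primitive, so
      \<open>P\<close> fixes it. Its image under \<open>P\<close> is a length component of
      \<open>lin \<phi> f\<close>, hence zero.\<close>
    have "lin P (lin (D n) f) = lin (D n) f"
    proof (rule lin_P_if_kernel[OF keys_lin_D[OF f]])
      fix k assume k: "k < n"
      have "lin (under k rcomult_hd) (lin (D n) f) = lin (D (Suc n)) f"
        unfolding lin_lin by (rule lin_cong) (use f k lin_under_rcomult_D in \<open>auto simp: span_of_def simp del: D.simps\<close>)
      then show "lin (under k rcomult_hd) (lin (D n) f) = 0" by (simp only: D_Suc)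
    qed
    then show ?case using P0 by simp
  qed
  \<comment> \<open>\<open>f\<close> is recovered from two iterates: \<open>D (Suc 0)\<close> keeps
    each basis element other than \<open>u\<close> as a one-letter word, read off by
    \<open>hd\<close>, and \<open>D 0\<close> keeps the coefficient of \<open>u\<close>.\<close>
  have "lin basisv f = lin (\<lambda>m. lin (\<lambda>l. basisv (hd l)) (D (Suc 0) m) + lin (\<lambda>l. basisv u) (D 0 m)) f"
    by (rule lin_cong) (use f D_1 in \<open>auto simp: span_of_def simp del: D.simps(2)\<close>)
  also have "\<dots> = lin (\<lambda>l. basisv (hd l)) (lin (D (Suc 0)) f) + lin (\<lambda>l. basisv u) (lin (D 0) f)"
    by (simp only: lin_fun_add lin_lin)
  finally show ?thesis by (simp add: Dn del: D.simps lin_lin)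
qed

section \<open>Surjectivity\<close>

lemma lin_P_tens_power:
  assumes "z \<in> tens_power prim n"
  shows "lin P z = z"
proof -
  have sub: "pm.subspace {z. lin P z = z}"
    unfolding pm.subspace_def by simp
  have "lin P (tensor_list ws) = tensor_list ws" if "set ws \<subseteq> prim" for ws
    using that
  proof (induction ws)
    case (Cons w ws)
    have "lin P (tensor_list (w # ws)) =
      lin (\<lambda>b. lin (\<lambda>bs. lin (\<lambda>a. lin (\<lambda>as. basisv (a # as)) (P bs)) (\<pi> b)) (tensor_list ws)) w"
      by simp
    also have "\<dots> = lin (\<lambda>b. lin (\<lambda>a. lin (\<lambda>bs. lin (\<lambda>as. basisv (a # as)) (P bs)) (tensor_list ws)) (\<pi> b)) w"
      by (intro lin_cong lin_commute)
    also have "\<dots> = lin (\<lambda>a. lin (\<lambda>as. basisv (a # as)) (lin P (tensor_list ws))) (lin \<pi> w)"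
      by simp
    also have "\<dots> = tensor_list (w # ws)"
      using Cons proj_prim[of w] by simp
    finally show ?case .
  qed simp
  then have "tens_power prim n \<subseteq> {z. lin P z = z}"
    unfolding tens_power_eq_span by (intro pm.span_minimal[OF _ sub]) auto
  then show ?thesis using assms by blast
qed

lemma subspace_sym_coalg: "pm.subspace (sym_coalg prim)"
proof -
  have sym: "pm.subspace (sym_tens prim n)" for n
  proof -
    have "sym_tens prim n = tens_power prim n \<inter> {z. swap_invariant z}"
      using sym_tens_iff by blast
    moreover have "pm.subspace {z :: 'a list \<Rightarrow>\<^sub>0 'b. swap_invariant z}"
      by (simp add: pm.subspace_def swap_invariant_def)
    ultimately show ?thesis
      unfolding tens_power_eq_span by (simp only: pm.subspace_inter[OF pm.subspace_span])
  qed
  show ?thesis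
    using sym unfolding pm.subspace_def sym_coalg_def len_part_def by simp
qed

lemma \<phi>_surj:
  assumes "z \<in> sym_coalg prim"
  shows "\<exists>f\<in>span_of M. lin \<phi> f = z"
proof -
  \<comment> \<open>Induction on a strict bound \<open>N\<close> for the lengths of the words in
    \<open>z\<close>; each step removes the top component.\<close>
  have "\<exists>f\<in>span_of M. lin \<phi> f = z" if "z \<in> sym_coalg prim" "\<forall>n\<ge>N. len_part n z = 0" for N
    using that
  proof (induction N arbitrary: z)
    case 0
    have "z = 0"
    proof (rule poly_mapping_eqI)
      fix l show "Poly_Mapping.lookup z l = Poly_Mapping.lookup 0 l"
        using lookup_len_part[of "length l" z l] 0(2) by simp
    qed
    then show ?case using subspace_span_of[of M] by (intro bexI[of _ 0]) (auto simp: pm.subspace_def)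
  next
    case (Suc N)
    define y where "y = len_part N z"
    have y: "y \<in> tens_power prim N" "swap_invariant y"
      using Suc.prems(1) by (auto simp: y_def sym_coalg_def sym_tens_iff)
    \<comment> \<open>The iterate of order \<open>N\<close> symmetrizes \<open>y\<close> and so
      multiplies it by \<open>fact N\<close>, which this scalar cancels.\<close>
    define x where "x = scal (1 / fact N) (lin nest y)"
    have nest_y: "lin nest y \<in> span_of M"
      using keys_tens_power[OF y(1)] nest_in by (auto simp: span_of_def keys_basisv elim!: keys_linE)
    then have x: "x \<in> span_of M"
      unfolding x_def by (rule pm.subspace_scale[OF subspace_span_of])
    have Dx: "lin (D k) x = (if k = N then y else 0)" if "N \<le> k" for k
    proof (cases "k = N")
      case True
      have "lin symmetrize y = scal (fact N) y"
        by (rule lin_symmetrize) (use keys_tens_power[OF y(1)] y(2) in auto)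
      then show ?thesis using True D_nest(1)[OF y(1)]
        by (simp add: x_def del: lin_lin)
    next
      case False
      then show ?thesis using that D_nest(2)[OF y(1), of k]
        by (simp add: x_def del: lin_lin)
    qed
    have "\<exists>f\<in>span_of M. lin \<phi> f = z - lin \<phi> x"
    proof (rule Suc.IH)
      show "z - lin \<phi> x \<in> sym_coalg prim"
        by (rule pm.subspace_diff[OF subspace_sym_coalg Suc.prems(1) \<phi>_in_sym_coalg[OF x]])
      show "\<forall>n\<ge>N. len_part n (z - lin \<phi> x) = 0"
      proof (intro allI impI)
        fix n assume n: "N \<le> n"
        have "len_part n (z - lin \<phi> x) = len_part n z - lin P (lin (D n) x)"
          using len_part_\<phi>[OF x] by (simp add: len_part_def lin_diff)
        also have "\<dots> = 0"
          using Dx[OF n] lin_P_tens_power[OF y(1)] Suc.prems(2) n by (auto simp: y_def)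
        finally show "len_part n (z - lin \<phi> x) = 0" .
      qed
    qed
    then obtain f where f: "f \<in> span_of M" "lin \<phi> f = z - lin \<phi> x" by blast
    then have "lin \<phi> (f + x) = z" by simp
    then show ?case using pm.subspace_add[OF subspace_span_of f(1) x] by blast
  qed
  moreover obtain N where "\<And>l. l \<in> Poly_Mapping.keys z \<Longrightarrow> length l < N"
    using finite_keys[of z] finite_nat_set_iff_bounded[of "length ` Poly_Mapping.keys z"] by auto
  then have "len_part n z = 0" if "N \<le> n" for n
    using that by (intro poly_mapping_eqI) (fastforce simp: lookup_len_part in_keys_iff)
  ultimately show ?thesis using assms by blast
qed

section \<open>The isomorphism of graded counital coalgebras\<close>

lemma bij_betw_\<phi>: "bij_betw (lin \<phi>) (span_of M) (sym_coalg prim)"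
proof (rule bij_betw_imageI)
  show "inj_on (lin \<phi>) (span_of M)"
  proof (rule inj_onI)
    fix f g assume "f \<in> span_of M" "g \<in> span_of M" "lin \<phi> f = lin \<phi> g"
    then show "f = g"
      using \<phi>_eq_0[of "f - g"] pm.subspace_diff[OF subspace_span_of, of f M g] by (simp add: lin_diff)
  qed
  show "lin \<phi> ` span_of M = sym_coalg prim"
    using \<phi>_in_sym_coalg \<phi>_surj by blast
qed

lemma tensmap_\<phi>:
  assumes "f \<in> span_of M"
  shows "tensmap (lin \<phi>) (lin \<phi>) (lin \<Delta> f) = deconc (lin \<phi> f)"
  unfolding tensmap_def deconc_def lin_lin
proof (rule lin_cong)
  fix m assume "m \<in> Poly_Mapping.keys f"
  then have "m \<in> M" using assms by (auto simp: span_of_def)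
  from deconc_\<phi>[OF this]
  show "lin (\<lambda>(b, c). tens (lin \<phi> (basisv b)) (lin \<phi> (basisv c))) (\<Delta> m) =
    lin (\<lambda>l. \<Sum>i\<le>length l. basisv (take i l, drop i l)) (\<phi> m)"
    by (simp add: deconc_def case_prod_unfold)
qed

lemma tcounit_\<phi>:
  assumes "f \<in> span_of M"
  shows "tcounit (lin \<phi> f) = Poly_Mapping.lookup f u"
proof -
  have "tcounit (lin \<phi> f) = Poly_Mapping.lookup (len_part 0 (lin \<phi> f)) []"
    by (simp add: tcounit_def lookup_len_part)
  also have "\<dots> = Poly_Mapping.lookup (lin (\<lambda>m. if m = u then basisv [] else 0) f) ([] :: 'a list)"
    by (simp add: len_part_\<phi>[OF assms] if_distrib[of "lin _"] cong: if_cong)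
  also have "\<dots> = Poly_Mapping.lookup (lin basisv f) u"
    unfolding lookup_lin by (rule sum.cong) (auto simp: lookup_basisv)
  finally show ?thesis by simp
qed

end

text \<open>The claim does not mention a projection, so any graded one may be chosen to build the
  morphism.\<close>

theorem (in connected_magma_coalgebra) cofree:
  "\<exists>\<phi>. bij_betw (lin \<phi>) (span_of M) (sym_coalg prim)
     \<and> (\<forall>f\<in>span_of M. tensmap (lin \<phi>) (lin \<phi>) (lin \<Delta> f) = deconc (lin \<phi> f))
     \<and> (\<forall>f\<in>span_of M. tcounit (lin \<phi> f) = Poly_Mapping.lookup f u)
     \<and> (\<forall>f\<in>span_of M. \<forall>d. homog dg d f \<longrightarrow> homog (\<lambda>l. sum_list (map dg l)) d (lin \<phi> f))"
proof -
  obtain \<pi> where "\<And>b. \<pi> b \<in> prim" "\<And>b. homog dg (dg b) (\<pi> b)" "\<And>w. w \<in> prim \<Longrightarrow> lin \<pi> w = w"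
    using graded_projection_exists by blast
  then interpret projected_magma_coalgebra M u \<Delta> dg mul \<pi>
    by unfold_locales
  show ?thesis
    using bij_betw_\<phi> tensmap_\<phi> tcounit_\<phi> homog_lin_\<phi> by blast
qed

section \<open>The co-addition on trees\<close>

lemma map_filter_id_Cons [simp]:
  "List.map_filter id (None # ms) = List.map_filter id ms"
  "List.map_filter id (Some t # ms) = t # List.map_filter id ms"
  "List.map_filter id [] = []"
  by (simp_all add: List.map_filter_simps)

lemma map_filter_id_append:
  "List.map_filter id (ms @ ms') = List.map_filter id ms @ List.map_filter id ms'"
  by (simp add: List.map_filter_def)

lemma map_filter_id_map_Some [simp]: "List.map_filter id (map Some ts) = ts"
  by (induction ts) auto

lemma set_map_filter_id: "t \<in> set (List.map_filter id ms) \<longleftrightarrow> Some t \<in> set ms"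
  by (force simp: List.map_filter_def)

lemma map_filter_id_eq_Nil: "List.map_filter id ms = [] \<longleftrightarrow> (\<forall>m\<in>set ms. m = None)"
  by (auto simp: List.map_filter_def filter_empty_conv)

lemma graft_cong: "List.map_filter id ms = List.map_filter id ms' \<Longrightarrow> graft ms = graft ms'"
  by (simp add: graft_def)

lemma graft_map_Some: "2 \<le> length ts \<Longrightarrow> graft (map Some ts) = Some (Node ts)"
  by (cases ts; cases "tl ts") (auto simp: graft_def)

lemma graft_eq_None_iff: "graft ms = None \<longleftrightarrow> (\<forall>m\<in>set ms. m = None)"
  unfolding map_filter_id_eq_Nil[symmetric] by (auto simp: graft_def split: list.splits)

lemma graft_single [simp]: "graft [m] = m"
  by (cases m) (auto simp: graft_def)

lemma graft_None_left [simp]: "graft [None, m] = m"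
  by (cases m) (auto simp: graft_def)

lemma graft_None_right [simp]: "graft [m, None] = m"
  by (cases m) (auto simp: graft_def)

lemma mdeg_graft: "mdeg (graft ms) = sum_list (map mdeg ms)"
proof -
  have "mdeg (graft ms) = sum_list (map leaves (List.map_filter id ms))"
    by (auto simp: graft_def mdeg_def split: list.splits)
  also have "\<dots> = sum_list (map mdeg ms)"
    by (induction ms) (auto simp: mdeg_def split: option.splits)
  finally show ?thesis .
qed

section \<open>Co-addition of a grafting\<close>

abbreviation tens_trees :: "'x tree list \<Rightarrow> (('x tree option \<times> 'x tree option) list \<Rightarrow>\<^sub>0 'k::comm_ring_1)" where
  "tens_trees ts \<equiv> tensor_list (map coadd_tree ts)"

abbreviation graft_pairs :: "('x tree option \<times> 'x tree option) list \<Rightarrow> 'x tree option \<times> 'x tree option" where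
  "graft_pairs ps \<equiv> (graft (map fst ps), graft (map snd ps))"

lemma coadd_basis_Some [simp]: "coadd_basis (Some t) = coadd_tree t"
  and coadd_basis_None [simp]: "coadd_basis None = basisv (None, None)"
  by (simp_all add: coadd_basis_def)

lemma coadd_tree_Node: "coadd_tree (Node ts) = lin (\<lambda>ps. basisv (graft_pairs ps)) (tens_trees ts)"
  by (simp add: vee2_def mlin_conv_tensor_list)

declare coadd_tree.simps(2) [simp del]

text \<open>The co-addition is a homomorphism under the unit conventions. A unit argument has
  coproduct \<open>basisv (None, None)\<close>, which grafting ignores in both components. This
  leaves nonempty trees, where the claim is the recursion of \<open>coadd_tree\<close>, or trivial
  for fewer than two trees.\<close>

lemma coadd_basis_graft:
  "(coadd_basis (graft ms) :: _ \<Rightarrow>\<^sub>0 'k::comm_ring_1) =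
    lin (\<lambda>ps. basisv (graft_pairs ps)) (tensor_list (map coadd_basis ms))"
proof -
  \<comment> \<open>\<open>flt\<close> deletes the units in both components and \<open>gr\<close>
    grafts what remains. As grafting depends only on this, unit arguments can be removed before
    grafting.\<close>
  define flt where "flt ps = (List.map_filter id (map fst ps), List.map_filter id (map snd ps))"
    for ps :: "('a tree option \<times> 'a tree option) list"
  define gr where "gr tt = (graft (map Some (fst tt)), graft (map Some (snd tt)))"
    for tt :: "'a tree list \<times> 'a tree list"
  have gr_flt: "gr (flt ps) = graft_pairs ps" for ps
    by (auto simp: gr_def flt_def intro!: graft_cong)
  define fl1 where "fl1 p = flt [p]" for p
  have flt_Cons: "flt (p # ps) = (fst (fl1 p) @ fst (flt ps), snd (fl1 p) @ snd (flt ps))" for p ps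
    using map_filter_id_append[of "[fst p]" "map fst ps"] map_filter_id_append[of "[snd p]" "map snd ps"]
    by (simp add: flt_def fl1_def)
  have "lin (\<lambda>ps. basisv (flt ps)) (tensor_list (map coadd_basis ms)) =
      (lin (\<lambda>ps. basisv (flt ps)) (tens_trees (List.map_filter id ms)) :: _ \<Rightarrow>\<^sub>0 'k)"
  proof (induction ms)
    case (Cons m ms)
    let ?g = "\<lambda>p tt. basisv (fst (fl1 p) @ fst tt, snd (fl1 p) @ snd tt) :: _ \<Rightarrow>\<^sub>0 'k"
    have "lin (\<lambda>ps. basisv (flt ps)) (tensor_list (map coadd_basis (m # ms))) =
        lin (\<lambda>p. lin (?g p) (lin (\<lambda>ps. basisv (flt ps)) (tensor_list (map coadd_basis ms)))) (coadd_basis m)"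
      by (simp add: flt_Cons)
    also have "\<dots> = lin (\<lambda>p. lin (?g p) (lin (\<lambda>ps. basisv (flt ps)) (tens_trees (List.map_filter id ms)))) (coadd_basis m)"
      unfolding Cons.IH ..
    also have "\<dots> = lin (\<lambda>ps. basisv (flt ps)) (tens_trees (List.map_filter id (m # ms)))"
      by (cases m) (simp_all add: flt_Cons, simp_all add: fl1_def flt_def)
    finally show ?case .
  qed simp
  from arg_cong[OF this, of "lin (\<lambda>tt. basisv (gr tt))"]
  have eq: "lin (\<lambda>ps. basisv (graft_pairs ps)) (tensor_list (map coadd_basis ms)) =
      (lin (\<lambda>ps. basisv (graft_pairs ps)) (tens_trees (List.map_filter id ms)) :: _ \<Rightarrow>\<^sub>0 'k)"
    by (simp add: gr_flt)
  consider "List.map_filter id ms = []" | t where "List.map_filter id ms = [t]"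
    | "2 \<le> length (List.map_filter id ms)"
    by (cases "List.map_filter id ms"; cases "tl (List.map_filter id ms)") auto
  then show ?thesis
  proof cases
    case 1
    then show ?thesis unfolding eq by (simp add: graft_def)
  next
    case (2 t)
    then have "graft ms = Some t" by (simp add: graft_def)
    then show ?thesis unfolding eq 2 by simp
  next
    case 3
    have "graft ms = graft (map Some (List.map_filter id ms))" by (rule graft_cong) simp
    then show ?thesis unfolding eq using 3 by (simp add: graft_map_Some coadd_tree_Node)
  qed
qed

section \<open>Coalgebra laws on trees\<close>

lemma coadd_tree_cocomm: "lin (\<lambda>p. basisv (snd p, fst p)) (coadd_tree t) = (coadd_tree t :: _ \<Rightarrow>\<^sub>0 'k::comm_ring_1)"
proof (induction t)
  case (Leaf x)
  show ?case by (simp add: add.commute)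
next
  case (Node ts)
  have "lin (\<lambda>ps. basisv (map snd ps, map fst ps)) (tens_trees ts) =
      (lin (\<lambda>ps. basisv (map fst ps, map snd ps)) (tens_trees ts) :: _ \<Rightarrow>\<^sub>0 'k)"
    using Node
  proof (induction ts)
    case (Cons t ts)
    let ?g = "\<lambda>p q. basisv (fst p # fst q, snd p # snd q) :: _ \<Rightarrow>\<^sub>0 'k"
    have "lin (\<lambda>ps. basisv (map snd ps, map fst ps)) (tens_trees (t # ts)) =
       lin (\<lambda>p. lin (?g p) (lin (\<lambda>ps. basisv (map snd ps, map fst ps)) (tens_trees ts)))
         (lin (\<lambda>p. basisv (snd p, fst p)) (coadd_tree t))"
      by simp
    also have "lin (\<lambda>p. basisv (snd p, fst p)) (coadd_tree t) = (coadd_tree t :: _ \<Rightarrow>\<^sub>0 'k)"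
      using Cons.prems by simp
    also have "lin (\<lambda>ps. basisv (map snd ps, map fst ps)) (tens_trees ts) =
        (lin (\<lambda>ps. basisv (map fst ps, map snd ps)) (tens_trees ts) :: _ \<Rightarrow>\<^sub>0 'k)"
      using Cons by simp
    finally show ?case by simp
  qed simp
  from arg_cong[OF this, of "lin (\<lambda>q. basisv (graft (fst q), graft (snd q)))"]
  show ?case by (simp add: coadd_tree_Node)
qed

text \<open>The law is first proved child by child for triples of words. The three graftings are
  applied at the end, and \<open>coadd_basis_graft\<close> identifies the result with the coproducts
  of grafted trees.\<close>

lemma coadd_tree_coassoc:
  "lin (\<lambda>p. lin (\<lambda>q. basisv (fst q, snd q, snd p)) (coadd_basis (fst p))) (coadd_tree t) =
   (lin (\<lambda>p. lin (\<lambda>q. basisv (fst p, fst q, snd q)) (coadd_basis (snd p))) (coadd_tree t) :: _ \<Rightarrow>\<^sub>0 'k::comm_ring_1)"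
proof (induction t)
  case (Leaf x)
  show ?case by (simp add: add_ac)
next
  case (Node ts)
  let ?L = "\<lambda>ts. lin (\<lambda>ps. lin (\<lambda>qs. basisv (map fst qs, map snd qs, map snd ps))
    (tensor_list (map coadd_basis (map fst ps)))) (tens_trees ts) :: _ \<Rightarrow>\<^sub>0 'k"
  let ?R = "\<lambda>ts. lin (\<lambda>ps. lin (\<lambda>qs. basisv (map fst ps, map fst qs, map snd qs))
    (tensor_list (map coadd_basis (map snd ps)))) (tens_trees ts) :: _ \<Rightarrow>\<^sub>0 'k"
  have "?L ts = ?R ts"
    using Node
  proof (induction ts)
    case (Cons t ts)
    let ?g = "\<lambda>r s. basisv (fst r # fst s, fst (snd r) # fst (snd s), snd (snd r) # snd (snd s)) :: _ \<Rightarrow>\<^sub>0 'k"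
    have "?L (t # ts) = lin (\<lambda>p. lin (\<lambda>ps. lin (\<lambda>q. lin (\<lambda>qs.
        ?g (fst q, snd q, snd p) (map fst qs, map snd qs, map snd ps))
        (tensor_list (map coadd_basis (map fst ps)))) (coadd_basis (fst p))) (tens_trees ts)) (coadd_tree t)"
      by simp
    \<comment> \<open>The sums are reordered so that the two coproducts of the first child become
      adjacent and coassociativity for that child applies.\<close>
    also have "\<dots> = lin (\<lambda>p. lin (\<lambda>q. lin (\<lambda>ps. lin (\<lambda>qs.
        ?g (fst q, snd q, snd p) (map fst qs, map snd qs, map snd ps))
        (tensor_list (map coadd_basis (map fst ps)))) (tens_trees ts)) (coadd_basis (fst p))) (coadd_tree t)"
      by (intro lin_cong lin_commute)
    also have "\<dots> = lin (\<lambda>r. lin (?g r) (?L ts))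
        (lin (\<lambda>p. lin (\<lambda>q. basisv (fst q, snd q, snd p)) (coadd_basis (fst p))) (coadd_tree t))"
      by simp
    also have "lin (\<lambda>p. lin (\<lambda>q. basisv (fst q, snd q, snd p)) (coadd_basis (fst p))) (coadd_tree t) =
        (lin (\<lambda>p. lin (\<lambda>q. basisv (fst p, fst q, snd q)) (coadd_basis (snd p))) (coadd_tree t) :: _ \<Rightarrow>\<^sub>0 'k)"
      using Cons.prems by simp
    also have "?L ts = ?R ts" using Cons.IH Cons.prems by simp
    also have "lin (\<lambda>r. lin (?g r) (?R ts))
        (lin (\<lambda>p. lin (\<lambda>q. basisv (fst p, fst q, snd q)) (coadd_basis (snd p))) (coadd_tree t)) =
      lin (\<lambda>p. lin (\<lambda>q. lin (\<lambda>ps. lin (\<lambda>qs.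
        ?g (fst p, fst q, snd q) (map fst ps, map fst qs, map snd qs))
        (tensor_list (map coadd_basis (map snd ps)))) (tens_trees ts)) (coadd_basis (snd p))) (coadd_tree t)"
      by simp
    also have "\<dots> = lin (\<lambda>p. lin (\<lambda>ps. lin (\<lambda>q. lin (\<lambda>qs.
        ?g (fst p, fst q, snd q) (map fst ps, map fst qs, map snd qs))
        (tensor_list (map coadd_basis (map snd ps)))) (coadd_basis (snd p))) (tens_trees ts)) (coadd_tree t)"
      by (intro lin_cong lin_commute)
    also have "\<dots> = ?R (t # ts)" by simp
    finally show ?case .
  qed simp
  from arg_cong[OF this, of "lin (\<lambda>r. basisv (graft (fst r), graft (fst (snd r)), graft (snd (snd r))))"]
  show ?case by (simp add: coadd_tree_Node coadd_basis_graft del: map_map)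
qed

text \<open>The first grafting is the unit only if all its arguments are, so the counit condition
  splits over the children. Reducedness gives at least two of them, so grafting them again returns
  the same node.\<close>

lemma coadd_tree_counit:
  "reduced t \<Longrightarrow> lin (\<lambda>p. if fst p = None then basisv (snd p) else 0) (coadd_tree t) =
     (basisv (Some t) :: _ \<Rightarrow>\<^sub>0 'k::comm_ring_1)"
proof (induction t)
  case (Leaf x)
  show ?case by simp
next
  case (Node ts)
  have "lin (\<lambda>ps. if \<forall>m\<in>set (map fst ps). m = None then basisv (map snd ps) else 0) (tens_trees ts) =
      (basisv (map Some ts) :: _ \<Rightarrow>\<^sub>0 'k)"
    using Node.IH Node.prems[unfolded reduced.simps, THEN conjunct2]
  proof (induction ts)
    case (Cons t ts)
    have "lin (\<lambda>ps. if \<forall>m\<in>set (map fst ps). m = None then basisv (map snd ps) else 0) (tens_trees (t # ts)) =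
      lin (\<lambda>p. lin (\<lambda>ps. if fst p = None then
        (if \<forall>m\<in>set (map fst ps). m = None then basisv (snd p # map snd ps) else 0) else 0) (tens_trees ts)) (coadd_tree t)"
      unfolding list.map tensor_list_Cons lin_lin lin_basisv by (intro lin_cong) auto
    also have "\<dots> = lin (\<lambda>m. lin (\<lambda>ms. basisv (m # ms))
        (lin (\<lambda>ps. if \<forall>m\<in>set (map fst ps). m = None then basisv (map snd ps) else 0) (tens_trees ts)))
        (lin (\<lambda>p. if fst p = None then basisv (snd p) else 0) (coadd_tree t))"
      unfolding lin_lin by (intro lin_cong) (auto intro!: lin_cong)
    also have "\<dots> = (basisv (map Some (t # ts)) :: _ \<Rightarrow>\<^sub>0 'k)"
      using Cons by simp
    finally show ?case .
  qed simp
  from arg_cong[OF this, of "lin (\<lambda>ms. basisv (graft ms))"]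
  have "lin (\<lambda>ps. if \<forall>m\<in>set (map fst ps). m = None then basisv (graft (map snd ps)) else 0) (tens_trees ts) =
      (basisv (Some (Node ts)) :: _ \<Rightarrow>\<^sub>0 'k)"
    using Node.prems by (simp add: graft_map_Some if_distrib[of "lin _"] cong: if_cong)
  then show ?case by (simp add: coadd_tree_Node graft_eq_None_iff cong: if_cong)
qed

section \<open>Degrees and supports of coproducts\<close>

lemma keys_coadd_tree_mdeg:
  "p \<in> Poly_Mapping.keys (coadd_tree t :: _ \<Rightarrow>\<^sub>0 'k::comm_ring_1) \<Longrightarrow>
     mdeg (fst p) + mdeg (snd p) = leaves t"
proof (induction t arbitrary: p)
  case (Leaf x)
  then show ?case
    using Poly_Mapping.keys_add[of "basisv (Some (Leaf x), None) :: _ \<Rightarrow>\<^sub>0 'k" "basisv (None, Some (Leaf x))"]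
    by (auto simp: keys_basisv mdeg_def)
next
  case (Node ts)
  then obtain ps where ps: "ps \<in> Poly_Mapping.keys (tens_trees ts :: _ \<Rightarrow>\<^sub>0 'k)" "p = graft_pairs ps"
    by (auto simp: coadd_tree_Node keys_basisv elim!: keys_linE)
  have "list_all2 (\<lambda>p t. p \<in> Poly_Mapping.keys (coadd_tree t :: _ \<Rightarrow>\<^sub>0 'k)) ps ts"
    using keys_tensor_list[OF ps(1)] by (simp add: list_all2_map2)
  then have "sum_list (map mdeg (map fst ps)) + sum_list (map mdeg (map snd ps)) = sum_list (map leaves ts)"
    using Node.IH by (induction rule: list_all2_induct) fastforce+
  then show ?case by (simp add: ps(2) mdeg_graft)
qed

text \<open>The predicate \<^term>\<open>k\<close> restricts the arities: \<^const>\<open>Mono_bin\<close> is only closed under grafting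
  pairs.\<close>

lemma keys_coadd_tree_closed:
  fixes S :: "'x tree set" and k :: "nat \<Rightarrow> bool"
  assumes leaf: "\<And>x. Leaf x \<in> S"
    and node: "\<And>ts. Node ts \<in> S \<Longrightarrow> set ts \<subseteq> S \<and> k (length ts)"
    and graft: "\<And>ms. set ms \<subseteq> insert None (Some ` S) \<Longrightarrow> k (length ms) \<Longrightarrow> graft ms \<in> insert None (Some ` S)"
  shows "t \<in> S \<Longrightarrow> p \<in> Poly_Mapping.keys (coadd_tree t :: _ \<Rightarrow>\<^sub>0 'k::comm_ring_1) \<Longrightarrow>
    fst p \<in> insert None (Some ` S) \<and> snd p \<in> insert None (Some ` S)"
proof (induction t arbitrary: p)
  case (Leaf x)
  then show ?case
    using Poly_Mapping.keys_add[of "basisv (Some (Leaf x), None) :: _ \<Rightarrow>\<^sub>0 'k" "basisv (None, Some (Leaf x))"]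
    by (auto simp: keys_basisv)
next
  case (Node ts)
  from Node.prems(2) obtain ps where ps: "ps \<in> Poly_Mapping.keys (tens_trees ts :: _ \<Rightarrow>\<^sub>0 'k)" "p = graft_pairs ps"
    by (auto simp: coadd_tree_Node keys_basisv elim!: keys_linE)
  have ts: "set ts \<subseteq> S" "k (length ts)" using node[OF Node.prems(1)] by auto
  have all: "list_all2 (\<lambda>p t. p \<in> Poly_Mapping.keys (coadd_tree t :: _ \<Rightarrow>\<^sub>0 'k)) ps ts"
    using keys_tensor_list[OF ps(1)] by (simp add: list_all2_map2)
  have "set (map fst ps) \<subseteq> insert None (Some ` S) \<and> set (map snd ps) \<subseteq> insert None (Some ` S)"
    using all ts(1) Node.IH
  proof (induction rule: list_all2_induct)
    case (Cons p ps t ts)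
    have "fst p \<in> insert None (Some ` S) \<and> snd p \<in> insert None (Some ` S)"
      using Cons.hyps Cons.prems by (intro Cons.prems(2)[of t]) auto
    moreover have "set (map fst ps) \<subseteq> insert None (Some ` S) \<and> set (map snd ps) \<subseteq> insert None (Some ` S)"
      using Cons.prems by (intro Cons.IH) auto
    ultimately show ?case by simp
  qed simp
  then show ?case
    using graft[of "map fst ps"] graft[of "map snd ps"] list_all2_lengthD[OF all] ts(2)
    by (simp add: ps(2))
qed

text \<open>The bound \<open>length ts \<le> length ms\<close> makes a newly formed root binary when
  two arguments are grafted.\<close>

lemma graft_cases:
  obtains "graft ms = None" | t where "graft ms = Some t" "Some t \<in> set ms"
    | ts where "graft ms = Some (Node ts)" "2 \<le> length ts" "length ts \<le> length ms" "Some ` set ts \<subseteq> set ms"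
proof -
  have len: "length (List.map_filter id ms) \<le> length ms"
    by (simp add: List.map_filter_def)
  consider "List.map_filter id ms = []" | t where "List.map_filter id ms = [t]"
    | a b ts where "List.map_filter id ms = a # b # ts"
    by (cases "List.map_filter id ms"; cases "tl (List.map_filter id ms)") auto
  then show thesis
  proof cases
    case 1
    then show thesis using that(1) by (simp add: graft_def)
  next
    case (2 t)
    then show thesis using that(2)[of t] set_map_filter_id[of t ms] by (simp add: graft_def)
  next
    case (3 a b ts)
    show thesis
    proof (rule that(3)[of "a # b # ts"])
      show "Some ` set (a # b # ts) \<subseteq> set ms"
        using set_map_filter_id[of _ ms] 3 by fastforce
    qed (use 3 len in \<open>simp_all add: graft_def\<close>)
  qed
qed

lemma Mono_simps [simp]:
  "None \<in> Mono_inf" "Some t \<in> Mono_inf \<longleftrightarrow> reduced t"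
  "None \<in> Mono_bin" "Some t \<in> Mono_bin \<longleftrightarrow> binary t"
  by (auto simp: Mono_inf_def Mono_bin_def)

lemma graft_Mono_inf: "set ms \<subseteq> Mono_inf \<Longrightarrow> graft ms \<in> Mono_inf"
  by (rule graft_cases[of ms]) (fastforce simp: image_subset_iff)+

lemma graft_Mono_bin: "\<lbrakk>set ms \<subseteq> Mono_bin; length ms = 2\<rbrakk> \<Longrightarrow> graft ms \<in> Mono_bin"
  by (rule graft_cases[of ms]) (fastforce simp: image_subset_iff)+

lemma binary_imp_reduced: "binary t \<Longrightarrow> reduced t"
  by (induction t) auto

lemma reduced_leaves_pos: "reduced t \<Longrightarrow> 0 < leaves t"
proof (induction t)
  case (Node ts)
  then show ?case by (cases ts) auto
qed simp

lemma keys_coadd_basis: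
  assumes M: "M = Mono_inf \<or> M = Mono_bin" and m: "m \<in> M"
    and p: "p \<in> Poly_Mapping.keys (coadd_basis m :: _ \<Rightarrow>\<^sub>0 'k::comm_ring_1)"
  shows "fst p \<in> M \<and> snd p \<in> M \<and> mdeg (fst p) + mdeg (snd p) = mdeg m"
proof (cases m)
  case None
  then show ?thesis using p m by (simp add: keys_basisv mdeg_def)
next
  case (Some t)
  have "mdeg (fst p) + mdeg (snd p) = mdeg m"
    using keys_coadd_tree_mdeg[of p t] p Some by (simp add: mdeg_def)
  moreover have "fst p \<in> M \<and> snd p \<in> M"
    using M
  proof
    assume "M = Mono_inf"
    then show ?thesis
      using keys_coadd_tree_closed[of "{t. reduced t}" "\<lambda>_. True" t p] p m Some graft_Mono_inf
      by (auto simp: Mono_inf_def)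
  next
    assume "M = Mono_bin"
    then show ?thesis
      using keys_coadd_tree_closed[of "{t. binary t}" "\<lambda>n. n = 2" t p] p m Some graft_Mono_bin
      by (auto simp: Mono_bin_def)
  qed
  ultimately show ?thesis by blast
qed

section \<open>The coalgebras of all reduced trees and of binary trees\<close>

text \<open>Grafting of two arguments serves as the product because both sets of monomials are
  closed under it; its compatibility with the co-addition is the case of two arguments in
  \<open>coadd_basis_graft\<close>.\<close>

lemma coadd_magma_coalgebra:
  assumes M: "M = Mono_inf \<or> M = Mono_bin"
  shows "connected_magma_coalgebra M None
    (coadd_basis :: _ \<Rightarrow> (_ \<Rightarrow>\<^sub>0 'k::field_char_0)) mdeg (\<lambda>a b. graft [a, b])"
proof
  have red: "reduced t" if "Some t \<in> M" for t
    using that M binary_imp_reduced by (auto simp: Mono_inf_def Mono_bin_def)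
  show "None \<in> M" using M by (auto simp: Mono_inf_def Mono_bin_def)
  fix m assume m: "m \<in> M"
  show "fst p \<in> M \<and> snd p \<in> M \<and> mdeg (fst p) + mdeg (snd p) = mdeg m"
    if "p \<in> Poly_Mapping.keys (coadd_basis m :: _ \<Rightarrow>\<^sub>0 'k)" for p
    by (rule keys_coadd_basis[OF M m that])
  show "mdeg m = 0 \<longleftrightarrow> m = None"
    using m reduced_leaves_pos[OF red] by (cases m) (auto simp: mdeg_def)
  show "lin (\<lambda>p. if fst p = None then basisv (snd p) else 0) (coadd_basis m) = (basisv m :: _ \<Rightarrow>\<^sub>0 'k)"
    using m coadd_tree_counit[OF red] by (cases m) auto
  show "lin (\<lambda>p. lin (\<lambda>q. basisv (fst q, snd q, snd p)) (coadd_basis (fst p))) (coadd_basis m) =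
      (lin (\<lambda>p. lin (\<lambda>q. basisv (fst p, fst q, snd q)) (coadd_basis (snd p))) (coadd_basis m) :: _ \<Rightarrow>\<^sub>0 'k)"
    by (cases m) (simp_all add: coadd_tree_coassoc)
  show "lin (\<lambda>p. basisv (snd p, fst p)) (coadd_basis m) = (coadd_basis m :: _ \<Rightarrow>\<^sub>0 'k)"
    by (cases m) (simp_all add: coadd_tree_cocomm)
next
  fix a b assume "a \<in> M" "b \<in> M"
  then show "graft [a, b] \<in> M"
    using M graft_Mono_inf[of "[a, b]"] graft_Mono_bin[of "[a, b]"] by auto
next
  fix a b :: "'a tree option"
  show "graft [a, b] = None \<Longrightarrow> a = None" by (simp add: graft_eq_None_iff)
  show "coadd_basis (graft [a, b]) = (lin (\<lambda>p. lin (\<lambda>q. basisv (graft [fst p, fst q], graft [snd p, snd q]))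
      (coadd_basis b)) (coadd_basis a) :: _ \<Rightarrow>\<^sub>0 'k)"
    by (simp add: coadd_basis_graft)
qed simp_all

theorem theorem4p7p6:
  fixes M :: "'x::countable tree option set"
  assumes "M = Mono_inf \<or> M = Mono_bin"
  shows "\<exists>\<phi> :: ('x tree option \<Rightarrow>\<^sub>0 'k::field_char_0) \<Rightarrow> ('x tree option list \<Rightarrow>\<^sub>0 'k).
           bij_betw \<phi> (span_of M) (sym_coalg (Wprim M))
         \<and> (\<forall>f\<in>span_of M. \<forall>g\<in>span_of M. \<phi> (f + g) = \<phi> f + \<phi> g)
         \<and> (\<forall>f\<in>span_of M. \<forall>c. \<phi> (scal c f) = scal c (\<phi> f))
         \<and> (\<forall>f\<in>span_of M. tensmap \<phi> \<phi> (coadd f) = deconc (\<phi> f))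
         \<and> (\<forall>f\<in>span_of M. tcounit (\<phi> f) = counit f)
         \<and> (\<forall>f\<in>span_of M. \<forall>d. homog mdeg d f \<longrightarrow> homog wdeg d (\<phi> f))"
proof -
  interpret connected_magma_coalgebra M None "coadd_basis :: _ \<Rightarrow> (_ \<Rightarrow>\<^sub>0 'k)" mdeg "\<lambda>a b. graft [a, b]"
    by (rule coadd_magma_coalgebra[OF assms])
  have W: "prim = Wprim M"
    by (auto simp: prim_def Wprim_def primitive_def coadd_def)
  have wdeg: "(\<lambda>l. sum_list (map mdeg l)) = wdeg"
    by (simp add: wdeg_def fun_eq_iff)
  obtain \<phi> :: "'x tree option \<Rightarrow> ('x tree option list \<Rightarrow>\<^sub>0 'k)" where "bij_betw (lin \<phi>) (span_of M) (sym_coalg (Wprim M))"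
    "\<forall>f\<in>span_of M. tensmap (lin \<phi>) (lin \<phi>) (coadd f) = deconc (lin \<phi> f)"
    "\<forall>f\<in>span_of M. tcounit (lin \<phi> f) = counit f"
    "\<forall>f\<in>span_of M. \<forall>d. homog mdeg d f \<longrightarrow> homog wdeg d (lin \<phi> f)"
    using cofree unfolding W wdeg coadd_def counit_def by blast
  then show ?thesis by (intro exI[of _ "lin \<phi>"]) simp
qed

end
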